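(* Let $p$ be a prime and $d\ge1$ an integer, and let $\mathbb F$ be the field of order $p^d$. Every fission of the coherent configuration $C(p^d)$ is separable, with the possible exception of those $(p,d)$ for which both of the following hold: (1) $p=2$ and $2\le d\le 20$, or $p=3$ and $2\le d\le 10$, or $p=5$ and $2\le d\le 6$; and (2) $(p,d)\notin\{(2,13),(2,17),(2,19),(3,7),(3,9),(5,5)\}$.
   Context: A coherent configuration is a pair $\mathcal X=(\Omega,S)$, where $\Omega$ is a finite set and $S$ is a partition of $\Omega\times\Omega$ such that the diagonal $1_\Omega$ is a union of elements of $S$, $S$ is closed under $r\mapsto r^*=\{(\beta,\alpha):(\alpha,\beta)\in r\}$, and for all $r,s,t\in S$ the number $c_{rs}^t=|\alpha r\cap\beta s^*|$ does not depend on $(\alpha,\beta)\in t$, where $\alpha r=\{\beta:(\alpha,\beta)\in r\}$. A fission of $\mathcal X$ is a coherent configuration $(\Omega,T)$ such that every element of $S$ is a union of elements of $T$. An isomorphism from $\mathcal X$ to $\mathcal X'=(\Omega',S')$ is a bijection $f:\Omega\to\Omega'$ with $\{s^f:s\in S\}=S'$; an algebraic isomorphism is a bijection $\varphi:S\to S'$ with $c_{rs}^t=c_{\varphi(r)\varphi(s)}^{\varphi(t)}$ for all $r,s,t$; it is induced by $f$ if $\varphi(s)=s^f$ for all $s$. $\mathcal X$ is separable if every algebraic isomorphism from $\mathcal X$ to any coherent configuration is induced by an isomorphism. $C(p^d)=C(\mathbb F)$ is the scheme on the point set $\mathbb F^\times$ whose basis relations are the sets $\{(ax^\sigma,ay^\sigma):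 a\in\mathbb F^\times,\ \sigma\in\mathrm{Aut}(\mathbb F)\}$, $x,y\in\mathbb F^\times$ (equivalently, the orbits on $\mathbb F^\times\times\mathbb F^\times$ of the group $\mathbb F^\times\rtimes\mathrm{Aut}(\mathbb F)$ acting by $u\mapsto au^\sigma$). *)

theory Defs
  imports
    "HOL-Library.Disjoint_Sets"
    "HOL-Algebra.QuotRing"
    "HOL-Computational_Algebra.Primes"
begin

text \<open>
  A configuration \<open>(\<Omega>, S)\<close> is given by its point set \<open>\<Omega> :: 'a set\<close> and its set
  \<open>S :: 'a rel set\<close> of basis relations. In the notation of the literature, \<open>\<alpha>r\<close> is
  \<open>r `` {\<alpha>}\<close> and \<open>r\<^sup>*\<close> is \<open>converse r\<close>.
\<close>

definition coherent_configuration :: "'a set \<Rightarrow> 'a rel set \<Rightarrow> bool" where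
  "coherent_configuration \<Omega> S \<longleftrightarrow>
     finite \<Omega> \<and>
     partition_on (\<Omega> \<times> \<Omega>) S \<and>
     (\<exists>D \<subseteq> S. Id_on \<Omega> = \<Union>D) \<and>
     (\<forall>r \<in> S. converse r \<in> S) \<and>
     (\<forall>r \<in> S. \<forall>s \<in> S. \<forall>t \<in> S. \<exists>c. \<forall>(\<alpha>, \<beta>) \<in> t.
        card (r `` {\<alpha>} \<inter> converse s `` {\<beta>}) = c)"

text \<open>The number \<open>c\<^bsub>rs\<^esub>\<^sup>t\<close>; well defined for basis relations of a coherent configuration, which
  are nonempty.\<close>

definition intersection_number :: "'a rel \<Rightarrow> 'a rel \<Rightarrow> 'a rel \<Rightarrow> nat" where
  "intersection_number r s t =
     (THE c. \<forall>(\<alpha>, \<beta>) \<in> t. card (r `` {\<alpha>} \<inter> converse s `` {\<beta>}) = c)"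

definition fission :: "'a set \<Rightarrow> 'a rel set \<Rightarrow> 'a rel set \<Rightarrow> bool" where
  "fission \<Omega> S T \<longleftrightarrow> coherent_configuration \<Omega> T \<and> (\<forall>s \<in> S. \<exists>U \<subseteq> T. s = \<Union>U)"

definition rel_image :: "('a \<Rightarrow> 'b) \<Rightarrow> 'a rel \<Rightarrow> 'b rel" where
  "rel_image f s = map_prod f f ` s"

definition cc_isomorphism ::
    "('a \<Rightarrow> 'b) \<Rightarrow> 'a set \<Rightarrow> 'a rel set \<Rightarrow> 'b set \<Rightarrow> 'b rel set \<Rightarrow> bool" where
  "cc_isomorphism f \<Omega> S \<Omega>' S' \<longleftrightarrow> bij_betw f \<Omega> \<Omega>' \<and> rel_image f ` S = S'"

definition algebraic_isomorphism ::
    "('a rel \<Rightarrow> 'b rel) \<Rightarrow> 'a rel set \<Rightarrow> 'b rel set \<Rightarrow> bool" where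
  "algebraic_isomorphism \<phi> S S' \<longleftrightarrow> bij_betw \<phi> S S' \<and>
     (\<forall>r \<in> S. \<forall>s \<in> S. \<forall>t \<in> S.
        intersection_number r s t = intersection_number (\<phi> r) (\<phi> s) (\<phi> t))"

text \<open>HOL cannot quantify over types inside a formula, so the type \<open>'b\<close> of the points of the
  second configuration is a parameter. It is meant to be left as a type variable in the conclusion
  of a theorem, where it is universally quantified.\<close>

definition separable :: "'b itself \<Rightarrow> 'a set \<Rightarrow> 'a rel set \<Rightarrow> bool" where
  "separable (_ :: 'b itself) \<Omega> S \<longleftrightarrow>
     (\<forall>(\<Omega>' :: 'b set) S' \<phi>.
        coherent_configuration \<Omega>' S' \<and> algebraic_isomorphism \<phi> S S' \<longrightarrow>
        (\<exists>f. cc_isomorphism f \<Omega> S \<Omega>' S' \<and> (\<forall>s \<in> S. \<phi> s = rel_image f s)))"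

text \<open>The scheme \<open>C(F)\<close> on the point set \<open>carrier F - {\<zero>\<^bsub>F\<^esub>}\<close>, the nonzero elements of \<open>F\<close>.
  Automorphisms are functions on the whole type of which only the values on the carrier matter.\<close>

definition C_basis :: "('a, 'm) ring_scheme \<Rightarrow> 'a rel set" where
  "C_basis F =
     {{(a \<otimes>\<^bsub>F\<^esub> \<sigma> x, a \<otimes>\<^bsub>F\<^esub> \<sigma> y) | a \<sigma>. a \<in> carrier F - {\<zero>\<^bsub>F\<^esub>} \<and> \<sigma> \<in> ring_iso F F}
      | x y. x \<in> carrier F - {\<zero>\<^bsub>F\<^esub>} \<and> y \<in> carrier F - {\<zero>\<^bsub>F\<^esub>}}"

end

theory Submission
  imports Defs "HOL-Algebra.Multiplicative_Group"
begin

text \<open>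
  Let \<open>k\<close> bound the valencies of a coherent configuration on \<open>n\<close> points, and let \<open>c\<close> bound the number
  of points that are in the same basis relation with two given distinct points. If \<open>3ck(k - 1) < n\<close>,
  then any three triples of points leave a further point \<open>\<zeta>\<close> in general position, and the lift of an
  algebraic isomorphism to a point map can be checked on triangles through \<open>\<zeta>\<close>. One fixes the image of
  a point \<open>\<alpha>\<close> and of a point \<open>\<gamma>\<close> with \<open>(\<alpha>, \<gamma>)\<close> in a relation of maximal valency at \<open>\<alpha>\<close>. These two
  images determine the images of most points, and the images of the remaining ones follow.

  Both bounds pass to fissions. For \<open>C(p\<^sup>d)\<close> all automorphisms of the field are powers of the Frobenius
  map, so \<open>k = d\<close> works, and so does the sum \<open>c\<close> of \<open>p\<^bsup>gcd(m, d)\<^esup> - 1\<close> for \<open>0 < m < d\<close>, whose terms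
  bound the number of nonzero solutions \<open>w\<close> of \<open>w\<^bsup>p^m\<^esup> = bw\<close>. The exceptions are exactly the pairs
  \<open>(p, d)\<close> with \<open>3cd(d - 1) \<ge> p\<^sup>d - 1\<close>.
\<close>

section \<open>Coherent configurations with many points\<close>

locale coherent =
  fixes \<Omega> :: "'a set" and S :: "'a rel set"
  assumes cc: "coherent_configuration \<Omega> S"
begin

definition rel :: "'a \<Rightarrow> 'a \<Rightarrow> 'a rel" where
  "rel \<alpha> \<beta> = (THE r. r \<in> S \<and> (\<alpha>, \<beta>) \<in> r)"

lemma finite_points: "finite \<Omega>"
  using cc by (simp add: coherent_configuration_def)

lemma basis_partition: "partition_on (\<Omega> \<times> \<Omega>) S"
  using cc by (simp add: coherent_configuration_def)

lemma rel_eq: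
  assumes "r \<in> S" "(\<alpha>, \<beta>) \<in> r"
  shows "rel \<alpha> \<beta> = r"
proof -
  have *: "s = r" if "s \<in> S" "(\<alpha>, \<beta>) \<in> s" for s
    using disjointD[OF partition_onD2[OF basis_partition] that(1) assms(1)] that(2) assms(2) by auto
  show ?thesis unfolding rel_def by (rule the_equality) (use assms in blast, erule conjE, rule *)
qed

lemma basisD:
  assumes "r \<in> S" "(\<alpha>, \<beta>) \<in> r"
  shows "\<alpha> \<in> \<Omega>" "\<beta> \<in> \<Omega>"
proof -
  have "(\<alpha>, \<beta>) \<in> \<Omega> \<times> \<Omega>" unfolding partition_onD1[OF basis_partition] using assms by blast
  then show "\<alpha> \<in> \<Omega>" "\<beta> \<in> \<Omega>" by auto
qed

lemma rel_basis:
  assumes "\<alpha> \<in> \<Omega>" "\<beta> \<in> \<Omega>"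
  shows "rel \<alpha> \<beta> \<in> S" and "(\<alpha>, \<beta>) \<in> rel \<alpha> \<beta>"
proof -
  obtain r where r: "r \<in> S" "(\<alpha>, \<beta>) \<in> r"
  proof -
    have "(\<alpha>, \<beta>) \<in> \<Union>S" unfolding partition_onD1[OF basis_partition, symmetric] using assms by blast
    then show ?thesis using that by blast
  qed
  show "rel \<alpha> \<beta> \<in> S" "(\<alpha>, \<beta>) \<in> rel \<alpha> \<beta>" unfolding rel_eq[OF r] by (fact r)+
qed

lemma mem_basis_iff:
  assumes "r \<in> S"
  shows "(\<alpha>, \<beta>) \<in> r \<longleftrightarrow> \<alpha> \<in> \<Omega> \<and> \<beta> \<in> \<Omega> \<and> rel \<alpha> \<beta> = r"
proof
  assume "(\<alpha>, \<beta>) \<in> r"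
  then show "\<alpha> \<in> \<Omega> \<and> \<beta> \<in> \<Omega> \<and> rel \<alpha> \<beta> = r" using assms by (metis rel_eq basisD)
next
  assume "\<alpha> \<in> \<Omega> \<and> \<beta> \<in> \<Omega> \<and> rel \<alpha> \<beta> = r"
  then show "(\<alpha>, \<beta>) \<in> r" using rel_basis(2)[of \<alpha> \<beta>] by simp
qed

lemma basis_nonempty:
  assumes "r \<in> S"
  obtains \<alpha> \<beta> where "\<alpha> \<in> \<Omega>" "\<beta> \<in> \<Omega>" "rel \<alpha> \<beta> = r"
proof -
  have "r \<noteq> {}" using partition_onD3[OF basis_partition] assms by auto
  then obtain \<alpha> \<beta> where "(\<alpha>, \<beta>) \<in> r" by auto
  then show thesis using that[of \<alpha> \<beta>] by (simp add: mem_basis_iff[OF assms])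
qed

lemma basis_converse: "r \<in> S \<Longrightarrow> converse r \<in> S"
  using cc by (simp add: coherent_configuration_def)

lemma rel_converse:
  assumes "\<alpha> \<in> \<Omega>" "\<beta> \<in> \<Omega>"
  shows "rel \<beta> \<alpha> = converse (rel \<alpha> \<beta>)"
  by (intro rel_eq basis_converse) (simp_all add: rel_basis assms)

lemma rel_converse_eq_iff:
  assumes "\<alpha> \<in> \<Omega>" "\<beta> \<in> \<Omega>" "\<gamma> \<in> \<Omega>" "\<delta> \<in> \<Omega>"
  shows "rel \<beta> \<alpha> = rel \<delta> \<gamma> \<longleftrightarrow> rel \<alpha> \<beta> = rel \<gamma> \<delta>"
  by (simp add: rel_converse[OF assms(1,2)] rel_converse[OF assms(3,4)])

lemma rel_diagonal:
  assumes "\<alpha> \<in> \<Omega>"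
  shows "rel \<alpha> \<alpha> \<subseteq> Id"
proof -
  obtain D where D: "D \<subseteq> S" "Id_on \<Omega> = \<Union>D"
    using cc unfolding coherent_configuration_def by blast
  then obtain r where r: "r \<in> D" "(\<alpha>, \<alpha>) \<in> r" using assms by blast
  then have "rel \<alpha> \<alpha> = r" "r \<subseteq> Id_on \<Omega>" using D rel_eq[OF _ r(2)] by auto
  then show ?thesis by auto
qed

lemma rel_eq_diagonal:
  assumes "\<alpha> \<in> \<Omega>" "\<beta> \<in> \<Omega>" "\<gamma> \<in> \<Omega>" "rel \<alpha> \<beta> = rel \<gamma> \<gamma>"
  shows "\<alpha> = \<beta>"
  using rel_basis(2)[OF assms(1,2)] rel_diagonal[OF assms(3)] assms(4) by auto

text \<open>Call \<open>rel \<alpha> \<beta>\<close> the colour of the pair. As the pair lies in its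
  own colour, the definite description in \<open>intersection_number\<close> can be evaluated there.
  From here on intersection numbers count the triangles over a base whose other two sides have
  prescribed colours.\<close>

lemma intersection_number_eq:
  assumes "r \<in> S" "s \<in> S" "\<alpha> \<in> \<Omega>" "\<beta> \<in> \<Omega>"
  shows "intersection_number r s (rel \<alpha> \<beta>) = card {\<gamma> \<in> \<Omega>. rel \<alpha> \<gamma> = r \<and> rel \<gamma> \<beta> = s}"
proof -
  have "rel \<alpha> \<beta> \<in> S" using assms rel_basis by blast
  then obtain c where c: "\<forall>(\<alpha>, \<beta>) \<in> rel \<alpha> \<beta>. card (r `` {\<alpha>} \<inter> converse s `` {\<beta>}) = c"
    using cc assms unfolding coherent_configuration_def by meson
  have m: "(\<alpha>, \<beta>) \<in> rel \<alpha> \<beta>" using assms rel_basis by blast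
  have "intersection_number r s (rel \<alpha> \<beta>) = c"
    unfolding intersection_number_def
  proof (rule the_equality)
    fix c' assume "\<forall>(\<alpha>, \<beta>) \<in> rel \<alpha> \<beta>. card (r `` {\<alpha>} \<inter> converse s `` {\<beta>}) = c'"
    then show "c' = c" using c m by auto
  qed (use c in blast)
  moreover have "r `` {\<alpha>} \<inter> converse s `` {\<beta>} = {\<gamma> \<in> \<Omega>. rel \<alpha> \<gamma> = r \<and> rel \<gamma> \<beta> = s}"
    using mem_basis_iff[OF assms(1)] mem_basis_iff[OF assms(2)] assms(3,4) by auto
  ultimately show ?thesis using c m by auto
qed

lemma intersection_number_pos:
  assumes "\<alpha> \<in> \<Omega>" "\<beta> \<in> \<Omega>" "\<gamma> \<in> \<Omega>"
  shows "intersection_number (rel \<alpha> \<gamma>) (rel \<gamma> \<beta>) (rel \<alpha> \<beta>) > 0"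
  using assms by (subst intersection_number_eq) (auto simp: rel_basis card_gt_0_iff finite_points)

lemma intersection_number_posD:
  assumes "r \<in> S" "s \<in> S" "\<alpha> \<in> \<Omega>" "\<beta> \<in> \<Omega>" "intersection_number r s (rel \<alpha> \<beta>) > 0"
  obtains \<gamma> where "\<gamma> \<in> \<Omega>" "rel \<alpha> \<gamma> = r" "rel \<gamma> \<beta> = s"
proof -
  have "{\<gamma> \<in> \<Omega>. rel \<alpha> \<gamma> = r \<and> rel \<gamma> \<beta> = s} \<noteq> {}"
    using assms by (intro notI) (simp add: intersection_number_eq)
  then show thesis using that by blast
qed

text \<open>Uniqueness of a third vertex becomes a statement about an intersection number. In this
  form it passes to every base of the same colour and through algebraic isomorphisms.\<close>

lemma intersection_number_1:
  assumes "\<alpha> \<in> \<Omega>" "\<beta> \<in> \<Omega>" "\<gamma> \<in> \<Omega>"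
    and "\<And>\<delta>. \<delta> \<in> \<Omega> \<Longrightarrow> rel \<alpha> \<delta> = rel \<alpha> \<gamma> \<Longrightarrow> rel \<delta> \<beta> = rel \<gamma> \<beta> \<Longrightarrow> \<delta> = \<gamma>"
  shows "intersection_number (rel \<alpha> \<gamma>) (rel \<gamma> \<beta>) (rel \<alpha> \<beta>) = 1"
proof -
  have "{\<delta> \<in> \<Omega>. rel \<alpha> \<delta> = rel \<alpha> \<gamma> \<and> rel \<delta> \<beta> = rel \<gamma> \<beta>} = {\<gamma>}"
    using assms by auto
  then show ?thesis using assms by (simp add: intersection_number_eq rel_basis)
qed

lemma intersection_number_1D:
  assumes "r \<in> S" "s \<in> S" "\<alpha> \<in> \<Omega>" "\<beta> \<in> \<Omega>" "intersection_number r s (rel \<alpha> \<beta>) = 1"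
    and "\<gamma> \<in> \<Omega>" "rel \<alpha> \<gamma> = r" "rel \<gamma> \<beta> = s"
    and "\<delta> \<in> \<Omega>" "rel \<alpha> \<delta> = r" "rel \<delta> \<beta> = s"
  shows "\<gamma> = \<delta>"
proof -
  have "card {\<gamma> \<in> \<Omega>. rel \<alpha> \<gamma> = r \<and> rel \<gamma> \<beta> = s} = 1"
    using assms(1-5) by (simp add: intersection_number_eq)
  then obtain x where "{\<gamma> \<in> \<Omega>. rel \<alpha> \<gamma> = r \<and> rel \<gamma> \<beta> = s} = {x}"
    by (rule card_1_singletonE)
  moreover have "\<gamma> \<in> {\<gamma> \<in> \<Omega>. rel \<alpha> \<gamma> = r \<and> rel \<gamma> \<beta> = s}" "\<delta> \<in> {\<gamma> \<in> \<Omega>. rel \<alpha> \<gamma> = r \<and> rel \<gamma> \<beta> = s}"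
    using assms(6-) by simp_all
  ultimately show ?thesis by simp
qed

text \<open>An existing triangle makes an intersection number positive, and that number depends only
  on the colour of the base. So the triangle has a congruent copy over each base of that
  colour.\<close>

lemma transport:
  assumes "\<alpha> \<in> \<Omega>" "\<beta> \<in> \<Omega>" "\<gamma> \<in> \<Omega>" "\<alpha>' \<in> \<Omega>" "\<beta>' \<in> \<Omega>" "rel \<alpha>' \<beta>' = rel \<alpha> \<beta>"
  obtains \<gamma>' where "\<gamma>' \<in> \<Omega>" "rel \<alpha>' \<gamma>' = rel \<alpha> \<gamma>" "rel \<gamma>' \<beta>' = rel \<gamma> \<beta>"
proof (rule intersection_number_posD[OF _ _ assms(4,5), of "rel \<alpha> \<gamma>" "rel \<gamma> \<beta>"])
  show "0 < intersection_number (rel \<alpha> \<gamma>) (rel \<gamma> \<beta>) (rel \<alpha>' \<beta>')"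
    using intersection_number_pos[OF assms(1-3)] assms(6) by simp
qed (use assms rel_basis in auto)

text \<open>Being intersection numbers, valencies are preserved by algebraic isomorphisms. The
  surjectivity of the point map will rest on this.\<close>

lemma valency_eq:
  assumes "r \<in> S" "\<alpha> \<in> \<Omega>"
  shows "intersection_number r (converse r) (rel \<alpha> \<alpha>) = card (r `` {\<alpha>})"
proof -
  have "rel \<gamma> \<alpha> = converse r \<longleftrightarrow> rel \<alpha> \<gamma> = r" if "\<gamma> \<in> \<Omega>" for \<gamma>
    using rel_converse[OF assms(2) that] by auto
  then have "{\<gamma> \<in> \<Omega>. rel \<alpha> \<gamma> = r \<and> rel \<gamma> \<alpha> = converse r} = r `` {\<alpha>}"
    using mem_basis_iff[OF assms(1)] assms(2) by blast
  then show ?thesis using assms by (simp add: intersection_number_eq basis_converse)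
qed

lemma basis_Image:
  assumes "\<alpha> \<in> \<Omega>" "\<beta> \<in> \<Omega>"
  shows "rel \<alpha> \<beta> `` {\<alpha>} = {\<gamma> \<in> \<Omega>. rel \<alpha> \<gamma> = rel \<alpha> \<beta>}"
  using mem_basis_iff[OF rel_basis(1)[OF assms]] assms by auto

text \<open>Let \<open>A\<close> and \<open>B\<close> consist of the points that
  \<open>\<alpha>\<close> sees in the colours of \<open>\<gamma>\<close> and
  \<open>\<epsilon>\<close>. By \<open>uniq\<close>, each point of \<open>B\<close> is joined in the
  colour \<open>rel \<gamma> \<epsilon>\<close> to exactly one point of \<open>A\<close>. This gives
  a map from \<open>B\<close> onto \<open>A\<close>, and since \<open>B\<close> is not larger than
  \<open>A\<close>, the map is injective. Hence \<open>\<alpha>\<close> and \<open>\<gamma>\<close>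
  determine \<open>\<epsilon>\<close> as soon as \<open>\<alpha>\<close> and
  \<open>\<epsilon>\<close> determine \<open>\<gamma>\<close>.\<close>

lemma unique_swap:
  assumes "\<alpha> \<in> \<Omega>" "\<gamma> \<in> \<Omega>" "\<epsilon> \<in> \<Omega>"
    and max: "card (rel \<alpha> \<epsilon> `` {\<alpha>}) \<le> card (rel \<alpha> \<gamma> `` {\<alpha>})"
    and uniq: "\<And>\<delta>. \<delta> \<in> \<Omega> \<Longrightarrow> rel \<alpha> \<delta> = rel \<alpha> \<gamma> \<Longrightarrow> rel \<delta> \<epsilon> = rel \<gamma> \<epsilon> \<Longrightarrow> \<delta> = \<gamma>"
    and \<delta>: "\<delta> \<in> \<Omega>" "rel \<alpha> \<delta> = rel \<alpha> \<epsilon>" "rel \<gamma> \<delta> = rel \<gamma> \<epsilon>"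
  shows "\<delta> = \<epsilon>"
proof -
  define A where "A = rel \<alpha> \<gamma> `` {\<alpha>}"
  define B where "B = rel \<alpha> \<epsilon> `` {\<alpha>}"
  have A: "A = {x \<in> \<Omega>. rel \<alpha> x = rel \<alpha> \<gamma>}" and B: "B = {x \<in> \<Omega>. rel \<alpha> x = rel \<alpha> \<epsilon>}"
    unfolding A_def B_def using assms basis_Image by auto
  have fin: "finite A" "finite B" using A B finite_points by auto
  have i1: "intersection_number (rel \<alpha> \<gamma>) (rel \<gamma> \<epsilon>) (rel \<alpha> \<epsilon>) = 1"
    by (rule intersection_number_1[OF assms(1,3,2) uniq])
  define h where "h y = (THE x. x \<in> A \<and> rel x y = rel \<gamma> \<epsilon>)" for y
  have h: "h y = x" if "x \<in> A" "y \<in> B" "rel x y = rel \<gamma> \<epsilon>" for x y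
    unfolding h_def
  proof (rule the_equality)
    fix z assume "z \<in> A \<and> rel z y = rel \<gamma> \<epsilon>"
    then show "z = x"
      using that A B assms i1
        intersection_number_1D[of "rel \<alpha> \<gamma>" "rel \<gamma> \<epsilon>" \<alpha> y z x] rel_basis by auto
  qed (use that in auto)
  \<comment> \<open>Surjectivity: the triangle on \<open>\<alpha>\<close>, \<open>\<gamma>\<close>,
    \<open>\<epsilon>\<close> is copied over the base from \<open>\<alpha>\<close> to
    \<open>x\<close>.\<close>
  have "A \<subseteq> h ` B"
  proof
    fix x assume "x \<in> A"
    then have "x \<in> \<Omega>" "rel \<alpha> x = rel \<alpha> \<gamma>" using A by auto
    then obtain y where "y \<in> \<Omega>" "rel \<alpha> y = rel \<alpha> \<epsilon>" "rel y x = rel \<epsilon> \<gamma>"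
      using transport[OF assms(1,2,3,1)] by metis
    then have "y \<in> B" "rel x y = rel \<gamma> \<epsilon>"
      using B rel_converse[OF \<open>y \<in> \<Omega>\<close> \<open>x \<in> \<Omega>\<close>] rel_converse[OF assms(3,2)] by auto
    then show "x \<in> h ` B" using h[OF \<open>x \<in> A\<close>] by blast
  qed
  then have "card A \<le> card (h ` B)" using fin by (intro card_mono) auto
  moreover have "card (h ` B) \<le> card B" by (rule card_image_le[OF fin(2)])
  moreover have "card B \<le> card A" using max by (simp add: A_def B_def)
  ultimately have "card (h ` B) = card B" by simp
  then have inj: "inj_on h B" using fin by (simp add: eq_card_imp_inj_on)
  have "\<gamma> \<in> A" "\<epsilon> \<in> B" "\<delta> \<in> B" using A B assms \<delta> by auto
  then have "h \<epsilon> = \<gamma>" "h \<delta> = \<gamma>" using h \<delta> by auto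
  then show ?thesis using inj \<open>\<epsilon> \<in> B\<close> \<open>\<delta> \<in> B\<close> by (auto dest: inj_onD)
qed

text \<open>A point \<open>\<epsilon>\<close> is good if only one basis relation can join the third vertex \<open>\<gamma>\<close> to \<open>\<beta>\<close> both in a
  triangle congruent to \<open>\<alpha>\<beta>\<gamma>\<close> and in one congruent to \<open>\<epsilon>\<beta>\<gamma>\<close>. This is a condition on intersection
  numbers, so algebraic isomorphisms preserve it: two correct triangles then yield a third one, as in
  the theorem of Desargues.\<close>

definition good :: "'a \<Rightarrow> 'a \<Rightarrow> 'a \<Rightarrow> 'a set" where
  "good \<alpha> \<beta> \<gamma> = {\<epsilon> \<in> \<Omega>. \<forall>\<gamma>\<^sub>1 \<in> \<Omega>. \<forall>\<gamma>\<^sub>2 \<in> \<Omega>. rel \<alpha> \<gamma>\<^sub>1 = rel \<alpha> \<gamma> \<longrightarrow> rel \<gamma>\<^sub>2 \<beta> = rel \<gamma>\<^sub>1 \<beta> \<longrightarrow>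
     rel \<epsilon> \<gamma>\<^sub>2 = rel \<epsilon> \<gamma> \<longrightarrow> rel \<gamma>\<^sub>1 \<beta> = rel \<gamma> \<beta>}"

end

section \<open>Triangles and algebraic isomorphisms\<close>

locale algebraically_isomorphic = X: coherent \<Omega> S + X': coherent \<Omega>' S'
  for \<Omega> :: "'a set" and S and \<Omega>' :: "'b set" and S' +
  fixes \<phi> :: "'a rel \<Rightarrow> 'b rel"
  assumes alg: "algebraic_isomorphism \<phi> S S'"
begin

lemma bij: "bij_betw \<phi> S S'"
  using alg by (simp add: algebraic_isomorphism_def)

lemma basis_image: "r \<in> S \<Longrightarrow> \<phi> r \<in> S'"
  using bij by (auto simp: bij_betw_def)

lemma phi_inject: "r \<in> S \<Longrightarrow> s \<in> S \<Longrightarrow> \<phi> r = \<phi> s \<longleftrightarrow> r = s"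
  using bij by (auto simp: bij_betw_def inj_on_eq_iff)

lemma phi_rel_inject:
  assumes "\<alpha> \<in> \<Omega>" "\<beta> \<in> \<Omega>" "\<gamma> \<in> \<Omega>" "\<delta> \<in> \<Omega>"
  shows "\<phi> (X.rel \<alpha> \<beta>) = \<phi> (X.rel \<gamma> \<delta>) \<longleftrightarrow> X.rel \<alpha> \<beta> = X.rel \<gamma> \<delta>"
  by (intro phi_inject X.rel_basis assms)

lemma phi_surj:
  assumes "r' \<in> S'"
  obtains r where "r \<in> S" "\<phi> r = r'"
  using bij assms by (auto simp: bij_betw_def)

lemma number_image:
  "r \<in> S \<Longrightarrow> s \<in> S \<Longrightarrow> t \<in> S \<Longrightarrow>
    intersection_number (\<phi> r) (\<phi> s) (\<phi> t) = intersection_number r s t"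
  using alg by (simp add: algebraic_isomorphism_def)

text \<open>As in \<open>transport\<close>, but between the two configurations:
  \<open>\<phi>\<close> preserves positive intersection numbers.\<close>

lemma transport_to:
  assumes "\<alpha> \<in> \<Omega>" "\<beta> \<in> \<Omega>" "\<gamma> \<in> \<Omega>" "\<alpha>' \<in> \<Omega>'" "\<beta>' \<in> \<Omega>'" "X'.rel \<alpha>' \<beta>' = \<phi> (X.rel \<alpha> \<beta>)"
  obtains \<gamma>' where "\<gamma>' \<in> \<Omega>'" "X'.rel \<alpha>' \<gamma>' = \<phi> (X.rel \<alpha> \<gamma>)" "X'.rel \<gamma>' \<beta>' = \<phi> (X.rel \<gamma> \<beta>)"
proof -
  have "intersection_number (\<phi> (X.rel \<alpha> \<gamma>)) (\<phi> (X.rel \<gamma> \<beta>)) (X'.rel \<alpha>' \<beta>') > 0"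
    using assms X.intersection_number_pos by (simp add: number_image X.rel_basis)
  then obtain \<gamma>' where "\<gamma>' \<in> \<Omega>'" "X'.rel \<alpha>' \<gamma>' = \<phi> (X.rel \<alpha> \<gamma>)" "X'.rel \<gamma>' \<beta>' = \<phi> (X.rel \<gamma> \<beta>)"
    using X'.intersection_number_posD[OF basis_image[OF X.rel_basis(1)[OF assms(1,3)]]
        basis_image[OF X.rel_basis(1)[OF assms(3,2)]] assms(4,5)] by blast
  then show thesis by (rule that)
qed

text \<open>The opposite direction. Surjectivity of \<open>\<phi>\<close> provides preimages of the
  two given colours, and the third vertex comes from a positive intersection number.\<close>

lemma transport_from:
  assumes "\<alpha> \<in> \<Omega>" "\<beta> \<in> \<Omega>" "\<gamma>' \<in> \<Omega>'" "\<alpha>' \<in> \<Omega>'" "\<beta>' \<in> \<Omega>'" "X'.rel \<alpha>' \<beta>' = \<phi> (X.rel \<alpha> \<beta>)"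
  obtains \<gamma> where "\<gamma> \<in> \<Omega>" "X'.rel \<alpha>' \<gamma>' = \<phi> (X.rel \<alpha> \<gamma>)" "X'.rel \<gamma>' \<beta>' = \<phi> (X.rel \<gamma> \<beta>)"
proof -
  obtain r where r: "r \<in> S" "\<phi> r = X'.rel \<alpha>' \<gamma>'"
    using phi_surj[OF X'.rel_basis(1)[OF assms(4,3)]] .
  obtain s where s: "s \<in> S" "\<phi> s = X'.rel \<gamma>' \<beta>'"
    using phi_surj[OF X'.rel_basis(1)[OF assms(3,5)]] .
  have "intersection_number r s (X.rel \<alpha> \<beta>) > 0"
    using number_image[OF r(1) s(1) X.rel_basis(1)[OF assms(1,2)]]
      X'.intersection_number_pos[OF assms(4,5,3)] assms(6) r s by simp
  then obtain \<gamma> where "\<gamma> \<in> \<Omega>" "X.rel \<alpha> \<gamma> = r" "X.rel \<gamma> \<beta> = s"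
    by (rule X.intersection_number_posD[OF r(1) s(1) assms(1,2)])
  then show thesis using that[of \<gamma>] r s by simp
qed

lemma transport_unique:
  assumes "\<alpha> \<in> \<Omega>" "\<beta> \<in> \<Omega>" "\<gamma> \<in> \<Omega>" "\<alpha>' \<in> \<Omega>'" "\<beta>' \<in> \<Omega>'" "X'.rel \<alpha>' \<beta>' = \<phi> (X.rel \<alpha> \<beta>)"
    and uniq: "\<And>\<delta>. \<delta> \<in> \<Omega> \<Longrightarrow> X.rel \<alpha> \<delta> = X.rel \<alpha> \<gamma> \<Longrightarrow> X.rel \<delta> \<beta> = X.rel \<gamma> \<beta> \<Longrightarrow> \<delta> = \<gamma>"
    and "\<gamma>' \<in> \<Omega>'" "X'.rel \<alpha>' \<gamma>' = \<phi> (X.rel \<alpha> \<gamma>)" "X'.rel \<gamma>' \<beta>' = \<phi> (X.rel \<gamma> \<beta>)"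
    and "\<delta>' \<in> \<Omega>'" "X'.rel \<alpha>' \<delta>' = \<phi> (X.rel \<alpha> \<gamma>)" "X'.rel \<delta>' \<beta>' = \<phi> (X.rel \<gamma> \<beta>)"
  shows "\<gamma>' = \<delta>'"
proof -
  have r: "X.rel \<alpha> \<gamma> \<in> S" "X.rel \<gamma> \<beta> \<in> S" "X.rel \<alpha> \<beta> \<in> S"
    by (simp_all only: assms(1-3) X.rel_basis)
  have "intersection_number (X.rel \<alpha> \<gamma>) (X.rel \<gamma> \<beta>) (X.rel \<alpha> \<beta>) = 1"
    by (rule X.intersection_number_1[OF assms(1,2,3) uniq])
  then have "intersection_number (\<phi> (X.rel \<alpha> \<gamma>)) (\<phi> (X.rel \<gamma> \<beta>)) (X'.rel \<alpha>' \<beta>') = 1"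
    by (simp only: assms(6) number_image[OF r])
  then show ?thesis
    by (rule X'.intersection_number_1D[OF basis_image[OF r(1)] basis_image[OF r(2)] assms(4,5) _ assms(8-13)])
qed

text \<open>An algebraic isomorphism is only required to preserve intersection numbers, so its
  effect on the diagonal has to be derived. Pulling \<open>\<beta>'\<close> back over the degenerate
  base from \<open>\<alpha>\<close> to \<open>\<alpha>\<close> gives a point \<open>\<gamma>\<close>
  that must be \<open>\<alpha>\<close>. Then the pair of \<open>\<alpha>'\<close> and
  \<open>\<beta>'\<close> has the same colour as the pair of \<open>\<beta>'\<close> with
  itself.\<close>

lemma rel_diagonal_image:
  assumes "\<alpha> \<in> \<Omega>" "\<alpha>' \<in> \<Omega>'" "\<beta>' \<in> \<Omega>'" "X'.rel \<alpha>' \<beta>' = \<phi> (X.rel \<alpha> \<alpha>)"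
  shows "\<alpha>' = \<beta>'"
proof -
  obtain \<gamma> where \<gamma>: "\<gamma> \<in> \<Omega>" "X'.rel \<alpha>' \<beta>' = \<phi> (X.rel \<alpha> \<gamma>)" "X'.rel \<beta>' \<beta>' = \<phi> (X.rel \<gamma> \<alpha>)"
    using transport_from[OF assms(1,1,3,2,3,4)] .
  then have "X.rel \<alpha> \<gamma> = X.rel \<alpha> \<alpha>"
    using assms(4) phi_rel_inject[OF assms(1) \<gamma>(1) assms(1,1)] by simp
  then have "\<gamma> = \<alpha>" using X.rel_eq_diagonal[OF assms(1) \<gamma>(1) assms(1)] by simp
  then have "X'.rel \<alpha>' \<beta>' = X'.rel \<beta>' \<beta>'" using \<gamma> by simp
  then show ?thesis by (rule X'.rel_eq_diagonal[OF assms(2,3,3)])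
qed

text \<open>Compatibility with converses is derived too: \<open>\<alpha>'\<close> with itself has
  the colour \<open>\<phi> (X.rel \<alpha> \<alpha>)\<close>, so \<open>\<beta>'\<close> can be
  pulled back over a degenerate base, which yields both orientations of the edge at once.\<close>

lemma rel_converse_image:
  assumes "\<alpha> \<in> \<Omega>" "\<beta> \<in> \<Omega>" "\<alpha>' \<in> \<Omega>'" "\<beta>' \<in> \<Omega>'" "X'.rel \<alpha>' \<beta>' = \<phi> (X.rel \<alpha> \<beta>)"
  shows "X'.rel \<beta>' \<alpha>' = \<phi> (X.rel \<beta> \<alpha>)"
proof -
  obtain \<alpha>\<^sub>0 where a: "\<alpha>\<^sub>0 \<in> \<Omega>'" "X'.rel \<alpha>' \<alpha>\<^sub>0 = \<phi> (X.rel \<alpha> \<alpha>)" "X'.rel \<alpha>\<^sub>0 \<beta>' = \<phi> (X.rel \<alpha> \<beta>)"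
    using transport_to[OF assms(1,2,1,3,4,5)] .
  have "X'.rel \<alpha>' \<alpha>' = \<phi> (X.rel \<alpha> \<alpha>)"
    using a(2) rel_diagonal_image[OF assms(1,3) a(1,2)] by simp
  then obtain \<beta>\<^sub>0 where b: "\<beta>\<^sub>0 \<in> \<Omega>" "X'.rel \<alpha>' \<beta>' = \<phi> (X.rel \<alpha> \<beta>\<^sub>0)" "X'.rel \<beta>' \<alpha>' = \<phi> (X.rel \<beta>\<^sub>0 \<alpha>)"
    by (rule transport_from[OF assms(1,1,4,3,3)])
  then have "X.rel \<alpha> \<beta>\<^sub>0 = X.rel \<alpha> \<beta>"
    using assms(5) phi_rel_inject[OF assms(1) b(1) assms(1,2)] by simp
  then have "X.rel \<beta>\<^sub>0 \<alpha> = X.rel \<beta> \<alpha>"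
    using X.rel_converse_eq_iff[OF assms(1) b(1) assms(1,2)] by simp
  then show ?thesis using b by simp
qed

text \<open>Pulling \<open>\<gamma>'\<close> back over the base from \<open>\<alpha>\<close> to
  \<open>\<beta>\<close> gives \<open>\<gamma>\<^sub>1\<close>, and over the base from
  \<open>\<epsilon>\<close> to \<open>\<beta>\<close> gives \<open>\<gamma>\<^sub>2\<close>. Both
  have the same colour towards \<open>\<beta>\<close>, namely the preimage of the colour from
  \<open>\<gamma>'\<close> to \<open>\<beta>'\<close>. Goodness of \<open>\<epsilon>\<close>
  identifies this colour with \<open>X.rel \<gamma> \<beta>\<close>.\<close>

lemma good_image:
  assumes "\<alpha> \<in> \<Omega>" "\<beta> \<in> \<Omega>" "\<gamma> \<in> \<Omega>" "\<epsilon> \<in> X.good \<alpha> \<beta> \<gamma>"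
    and "\<alpha>' \<in> \<Omega>'" "\<beta>' \<in> \<Omega>'" "\<gamma>' \<in> \<Omega>'" "\<epsilon>' \<in> \<Omega>'"
    and "X'.rel \<alpha>' \<beta>' = \<phi> (X.rel \<alpha> \<beta>)" "X'.rel \<alpha>' \<gamma>' = \<phi> (X.rel \<alpha> \<gamma>)"
    and "X'.rel \<epsilon>' \<beta>' = \<phi> (X.rel \<epsilon> \<beta>)" "X'.rel \<epsilon>' \<gamma>' = \<phi> (X.rel \<epsilon> \<gamma>)"
  shows "X'.rel \<gamma>' \<beta>' = \<phi> (X.rel \<gamma> \<beta>)"
proof -
  have \<epsilon>: "\<epsilon> \<in> \<Omega>" using assms by (simp add: X.good_def)
  obtain \<gamma>\<^sub>1 where 1: "\<gamma>\<^sub>1 \<in> \<Omega>" "X'.rel \<alpha>' \<gamma>' = \<phi> (X.rel \<alpha> \<gamma>\<^sub>1)" "X'.rel \<gamma>' \<beta>' = \<phi> (X.rel \<gamma>\<^sub>1 \<beta>)"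
    using transport_from[OF assms(1,2,7,5,6,9)] .
  obtain \<gamma>\<^sub>2 where 2: "\<gamma>\<^sub>2 \<in> \<Omega>" "X'.rel \<epsilon>' \<gamma>' = \<phi> (X.rel \<epsilon> \<gamma>\<^sub>2)" "X'.rel \<gamma>' \<beta>' = \<phi> (X.rel \<gamma>\<^sub>2 \<beta>)"
    using transport_from[OF \<epsilon> assms(2,7,8,6,11)] .
  have "X.rel \<alpha> \<gamma>\<^sub>1 = X.rel \<alpha> \<gamma>" "X.rel \<gamma>\<^sub>2 \<beta> = X.rel \<gamma>\<^sub>1 \<beta>" "X.rel \<epsilon> \<gamma>\<^sub>2 = X.rel \<epsilon> \<gamma>"
    using 1 2 assms \<epsilon> by (simp_all flip: phi_rel_inject)
  then have "X.rel \<gamma>\<^sub>1 \<beta> = X.rel \<gamma> \<beta>" using assms(4) 1 2 by (simp add: X.good_def)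
  then show ?thesis using 1 by simp
qed

text \<open>Injectivity holds because \<open>\<phi>\<close> separates diagonal from other colours.
  No equality of the numbers of points is assumed: a point \<open>\<beta>'\<close> is reached by
  comparing, around \<open>\<alpha>\<close> and \<open>f \<alpha>\<close>, the neighbourhoods in the
  colour of \<open>\<beta>'\<close>, which have equal valency.\<close>

lemma isomorphism_if_rel:
  assumes f: "\<And>\<alpha>. \<alpha> \<in> \<Omega> \<Longrightarrow> f \<alpha> \<in> \<Omega>'"
    and rel: "\<And>\<alpha> \<beta>. \<alpha> \<in> \<Omega> \<Longrightarrow> \<beta> \<in> \<Omega> \<Longrightarrow> X'.rel (f \<alpha>) (f \<beta>) = \<phi> (X.rel \<alpha> \<beta>)"
    and ne: "\<Omega> \<noteq> {}"
  shows "cc_isomorphism f \<Omega> S \<Omega>' S' \<and> (\<forall>s \<in> S. \<phi> s = rel_image f s)"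
proof -
  have inj: "inj_on f \<Omega>"
  proof (rule inj_onI)
    fix \<alpha> \<beta> assume *: "\<alpha> \<in> \<Omega>" "\<beta> \<in> \<Omega>" "f \<alpha> = f \<beta>"
    then have "\<phi> (X.rel \<alpha> \<beta>) = \<phi> (X.rel \<alpha> \<alpha>)" using rel by metis
    then have "X.rel \<alpha> \<beta> = X.rel \<alpha> \<alpha>" using phi_inject X.rel_basis * by metis
    then show "\<alpha> = \<beta>" using X.rel_eq_diagonal * by metis
  qed
  have surj: "\<beta>' \<in> f ` \<Omega>" if \<beta>': "\<beta>' \<in> \<Omega>'" for \<beta>'
  proof -
    obtain \<alpha> where \<alpha>: "\<alpha> \<in> \<Omega>" using ne by blast
    obtain s where s: "s \<in> S" "\<phi> s = X'.rel (f \<alpha>) \<beta>'"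
      using phi_surj[OF X'.rel_basis(1)[OF f[OF \<alpha>] \<beta>']] .
    obtain \<beta> where \<beta>: "\<beta> \<in> \<Omega>" "X'.rel (f \<alpha>) \<beta>' = \<phi> (X.rel \<alpha> \<beta>)"
      using transport_from[OF \<alpha> \<alpha> \<beta>' f[OF \<alpha>] f[OF \<alpha>] rel[OF \<alpha> \<alpha>]] by metis
    define r where "r = X.rel \<alpha> \<beta>"
    have r: "r \<in> S" "\<phi> r \<in> S'" "\<phi> (converse r) = converse (\<phi> r)"
    proof -
      show 1: "r \<in> S" "\<phi> r \<in> S'" using \<alpha> \<beta> X.rel_basis basis_image unfolding r_def by auto
      have "\<phi> (converse r) = X'.rel (f \<beta>) (f \<alpha>)"
        unfolding r_def X.rel_converse[OF \<alpha> \<beta>(1), symmetric] rel[OF \<beta>(1) \<alpha>] ..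
      also have "\<dots> = converse (\<phi> r)"
        using X'.rel_converse[OF f[OF \<alpha>] f[OF \<beta>(1)]] rel[OF \<alpha> \<beta>(1)] by (simp add: r_def)
      finally show "\<phi> (converse r) = converse (\<phi> r)" .
    qed
    have "card (r `` {\<alpha>}) = card (\<phi> r `` {f \<alpha>})"
      using number_image[OF r(1) X.basis_converse[OF r(1)] X.rel_basis(1)[OF \<alpha> \<alpha>]]
        X.valency_eq[OF r(1) \<alpha>] X'.valency_eq[OF r(2) f[OF \<alpha>]] r(3) rel[OF \<alpha> \<alpha>] by simp
    moreover have "f ` (r `` {\<alpha>}) \<subseteq> \<phi> r `` {f \<alpha>}"
      using X.mem_basis_iff[OF r(1)] X'.mem_basis_iff[OF r(2)] rel f by auto
    moreover have "inj_on f (r `` {\<alpha>})"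
      by (rule inj_on_subset[OF inj]) (use X.basisD[OF r(1)] in auto)
    moreover have "finite (\<phi> r `` {f \<alpha>})"
      by (rule finite_subset[OF _ X'.finite_points]) (use X'.basisD[OF r(2)] in auto)
    ultimately have "f ` (r `` {\<alpha>}) = \<phi> r `` {f \<alpha>}"
      by (intro card_subset_eq) (auto simp: card_image)
    moreover have "\<beta>' \<in> \<phi> r `` {f \<alpha>}"
      using X'.mem_basis_iff[OF r(2)] \<beta> \<beta>' f \<alpha> unfolding r_def by auto
    ultimately have "\<beta>' \<in> f ` (r `` {\<alpha>})" by simp
    then show ?thesis using X.basisD[OF r(1)] by auto
  qed
  have image: "\<phi> s = rel_image f s" if s: "s \<in> S" for s
  proof (rule subset_antisym; rule subsetI)
    fix x assume "x \<in> \<phi> s"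
    then obtain \<alpha>' \<beta>' where x: "x = (\<alpha>', \<beta>')" "\<alpha>' \<in> \<Omega>'" "\<beta>' \<in> \<Omega>'" "X'.rel \<alpha>' \<beta>' = \<phi> s"
      using X'.mem_basis_iff[OF basis_image[OF s]] by (cases x) auto
    then obtain \<alpha> \<beta> where ab: "\<alpha> \<in> \<Omega>" "\<beta> \<in> \<Omega>" "\<alpha>' = f \<alpha>" "\<beta>' = f \<beta>" using surj by blast
    then have "\<phi> (X.rel \<alpha> \<beta>) = \<phi> s" using rel x by metis
    then have "(\<alpha>, \<beta>) \<in> s" using phi_inject X.rel_basis s ab by metis
    then show "x \<in> rel_image f s" using x ab unfolding rel_image_def by force
  next
    fix x assume "x \<in> rel_image f s"
    then obtain \<alpha> \<beta> where ab: "(\<alpha>, \<beta>) \<in> s" "x = (f \<alpha>, f \<beta>)" unfolding rel_image_def by auto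
    then show "x \<in> \<phi> s"
      using X.mem_basis_iff[OF s] X'.mem_basis_iff[OF basis_image[OF s]] f rel by auto
  qed
  have "rel_image f ` S = S'"
  proof -
    have "rel_image f ` S = \<phi> ` S" by (rule image_cong) (simp_all add: image)
    then show ?thesis using bij by (simp add: bij_betw_def)
  qed
  moreover have "bij_betw f \<Omega> \<Omega>'" using inj surj f by (auto simp: bij_betw_def)
  ultimately show ?thesis using image by (simp add: cc_isomorphism_def)
qed

end

section \<open>Counting exceptional points\<close>

locale bounded_coherent = coherent +
  fixes k c :: nat
  assumes valency: "r \<in> S \<Longrightarrow> \<alpha> \<in> \<Omega> \<Longrightarrow> card (r `` {\<alpha>}) \<le> k"
    and indistinguishing: "\<alpha> \<in> \<Omega> \<Longrightarrow> \<beta> \<in> \<Omega> \<Longrightarrow> \<alpha> \<noteq> \<beta> \<Longrightarrow>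
      card {\<gamma> \<in> \<Omega>. \<exists>r \<in> S. (\<gamma>, \<alpha>) \<in> r \<and> (\<gamma>, \<beta>) \<in> r} \<le> c"
    and large: "3 * c * k * (k - 1) < card \<Omega>"
begin

lemma rel_right_card:
  assumes "\<alpha> \<in> \<Omega>" "\<beta> \<in> \<Omega>"
  shows "card {\<gamma> \<in> \<Omega>. rel \<alpha> \<gamma> = rel \<alpha> \<beta>} \<le> k"
  using valency[OF rel_basis(1)[OF assms] assms(1)] basis_Image[OF assms] by simp

lemma rel_left_card:
  assumes "\<alpha> \<in> \<Omega>" "\<beta> \<in> \<Omega>"
  shows "card {\<gamma> \<in> \<Omega>. rel \<gamma> \<beta> = rel \<alpha> \<beta>} \<le> k"
proof -
  have "{\<gamma> \<in> \<Omega>. rel \<gamma> \<beta> = rel \<alpha> \<beta>} = {\<gamma> \<in> \<Omega>. rel \<beta> \<gamma> = rel \<beta> \<alpha>}"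
    by (intro Collect_cong conj_cong refl rel_converse_eq_iff assms)
  then show ?thesis using rel_right_card[OF assms(2,1)] by simp
qed

lemma rel_left_eq_card:
  assumes "\<alpha> \<in> \<Omega>" "\<beta> \<in> \<Omega>" "\<alpha> \<noteq> \<beta>"
  shows "card {\<gamma> \<in> \<Omega>. rel \<gamma> \<alpha> = rel \<gamma> \<beta>} \<le> c"
proof -
  have "{\<gamma> \<in> \<Omega>. rel \<gamma> \<alpha> = rel \<gamma> \<beta>} \<subseteq> {\<gamma> \<in> \<Omega>. \<exists>r \<in> S. (\<gamma>, \<alpha>) \<in> r \<and> (\<gamma>, \<beta>) \<in> r}"
  proof
    fix \<gamma> assume "\<gamma> \<in> {\<gamma> \<in> \<Omega>. rel \<gamma> \<alpha> = rel \<gamma> \<beta>}"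
    then have "\<gamma> \<in> \<Omega>" "rel \<gamma> \<alpha> \<in> S" "(\<gamma>, \<alpha>) \<in> rel \<gamma> \<alpha>" "(\<gamma>, \<beta>) \<in> rel \<gamma> \<alpha>"
      using rel_basis[of \<gamma> \<alpha>] rel_basis[of \<gamma> \<beta>] assms by auto
    then show "\<gamma> \<in> {\<gamma> \<in> \<Omega>. \<exists>r \<in> S. (\<gamma>, \<alpha>) \<in> r \<and> (\<gamma>, \<beta>) \<in> r}" by blast
  qed
  then have "card {\<gamma> \<in> \<Omega>. rel \<gamma> \<alpha> = rel \<gamma> \<beta>}
      \<le> card {\<gamma> \<in> \<Omega>. \<exists>r \<in> S. (\<gamma>, \<alpha>) \<in> r \<and> (\<gamma>, \<beta>) \<in> r}"
    by (rule card_mono[rotated]) (simp add: finite_points)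
  then show ?thesis using indistinguishing[OF assms] by simp
qed

lemma rel_right_eq_card:
  assumes "\<alpha> \<in> \<Omega>" "\<beta> \<in> \<Omega>" "\<alpha> \<noteq> \<beta>"
  shows "card {\<gamma> \<in> \<Omega>. rel \<alpha> \<gamma> = rel \<beta> \<gamma>} \<le> c"
proof -
  have "{\<gamma> \<in> \<Omega>. rel \<alpha> \<gamma> = rel \<beta> \<gamma>} = {\<gamma> \<in> \<Omega>. rel \<gamma> \<alpha> = rel \<gamma> \<beta>}"
    by (intro Collect_cong conj_cong refl rel_converse_eq_iff assms)
  then show ?thesis using rel_left_eq_card[OF assms] by simp
qed

text \<open>A failure at \<open>\<epsilon>\<close> is witnessed by \<open>\<gamma>\<^sub>1\<close>
  and \<open>\<gamma>\<^sub>2\<close>, both different from \<open>\<gamma>\<close>. There are at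
  most \<open>k - 1\<close> choices for the first, at most \<open>k\<close> for the second once the
  first is known, and then at most \<open>c\<close> points \<open>\<epsilon>\<close> see
  \<open>\<gamma>\<^sub>2\<close> and \<open>\<gamma>\<close> in the same colour.\<close>

lemma not_good_card:
  assumes "\<alpha> \<in> \<Omega>" "\<beta> \<in> \<Omega>" "\<gamma> \<in> \<Omega>"
  shows "card (\<Omega> - good \<alpha> \<beta> \<gamma>) \<le> c * k * (k - 1)"
proof -
  define A where "A = {\<delta> \<in> \<Omega>. rel \<alpha> \<delta> = rel \<alpha> \<gamma>} - {\<gamma>}"
  define B where "B \<gamma>\<^sub>1 = {\<gamma>\<^sub>2 \<in> \<Omega>. rel \<gamma>\<^sub>2 \<beta> = rel \<gamma>\<^sub>1 \<beta>} - {\<gamma>}" for \<gamma>\<^sub>1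
  define C where "C \<gamma>\<^sub>2 = {\<epsilon> \<in> \<Omega>. rel \<epsilon> \<gamma>\<^sub>2 = rel \<epsilon> \<gamma>}" for \<gamma>\<^sub>2
  have fin: "finite A" "finite (B x)" "finite (C x)" for x
    unfolding A_def B_def C_def using finite_points by auto
  have A: "card A \<le> k - 1"
    unfolding A_def using rel_right_card[OF assms(1,3)] assms(3)
    by (simp add: card_Diff_singleton diff_le_mono)
  have B: "card (B x) \<le> k" if "x \<in> A" for x
  proof -
    have "card (B x) \<le> card {y \<in> \<Omega>. rel y \<beta> = rel x \<beta>}"
      unfolding B_def using finite_points by (intro card_mono) auto
    also have "\<dots> \<le> k" using that assms(2) by (intro rel_left_card) (auto simp: A_def)
    finally show ?thesis .
  qed
  have C: "card (C y) \<le> c" if "y \<in> B x" for x y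
    unfolding C_def using that assms(3) by (intro rel_left_eq_card) (auto simp: B_def)
  have "\<Omega> - good \<alpha> \<beta> \<gamma> \<subseteq> (\<Union>x\<in>A. \<Union>y\<in>B x. C y)"
  proof
    fix \<epsilon> assume "\<epsilon> \<in> \<Omega> - good \<alpha> \<beta> \<gamma>"
    then obtain x y where "\<epsilon> \<in> \<Omega>" "x \<in> \<Omega>" "y \<in> \<Omega>" "rel \<alpha> x = rel \<alpha> \<gamma>"
      "rel y \<beta> = rel x \<beta>" "rel \<epsilon> y = rel \<epsilon> \<gamma>" "rel x \<beta> \<noteq> rel \<gamma> \<beta>"
      unfolding good_def by blast
    then have "x \<in> A" "y \<in> B x" "\<epsilon> \<in> C y" unfolding A_def B_def C_def by auto
    then show "\<epsilon> \<in> (\<Union>x\<in>A. \<Union>y\<in>B x. C y)" by blast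
  qed
  then have "card (\<Omega> - good \<alpha> \<beta> \<gamma>) \<le> card (\<Union>x\<in>A. \<Union>y\<in>B x. C y)"
    using fin by (intro card_mono) auto
  also have "\<dots> \<le> (\<Sum>x\<in>A. card (\<Union>y\<in>B x. C y))" using fin by (intro card_UN_le)
  also have "\<dots> \<le> (\<Sum>x\<in>A. k * c)"
  proof (rule sum_mono)
    fix x assume x: "x \<in> A"
    have "card (\<Union>y\<in>B x. C y) \<le> (\<Sum>y\<in>B x. card (C y))" using fin by (intro card_UN_le)
    also have "\<dots> \<le> card (B x) * c" using C sum_bounded_above[of "B x" "\<lambda>y. card (C y)" c] by simp
    also have "\<dots> \<le> k * c" using B[OF x] by simp
    finally show "card (\<Union>y\<in>B x. C y) \<le> k * c" .
  qed
  also have "\<dots> = card A * (k * c)" by simp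
  also have "\<dots> \<le> (k - 1) * (k * c)" using A by (rule mult_le_mono1)
  finally show ?thesis by (simp add: mult.commute mult.left_commute)
qed

text \<open>Equivalently, the relevant intersection number is 1: the colours from
  \<open>\<alpha>\<close> and to \<open>\<epsilon>\<close> pin down \<open>\<gamma>\<close>, and by
  \<open>transport_unique\<close> they also pin down its image.\<close>

definition determining :: "'a \<Rightarrow> 'a \<Rightarrow> 'a set" where
  "determining \<alpha> \<gamma> = {\<epsilon> \<in> \<Omega>. \<forall>\<delta> \<in> \<Omega>. rel \<alpha> \<delta> = rel \<alpha> \<gamma> \<longrightarrow> rel \<delta> \<epsilon> = rel \<gamma> \<epsilon> \<longrightarrow> \<delta> = \<gamma>}"

lemma not_determining_card:
  assumes "\<alpha> \<in> \<Omega>" "\<gamma> \<in> \<Omega>"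
  shows "card (\<Omega> - determining \<alpha> \<gamma>) \<le> c * k * (k - 1)"
proof -
  define A where "A = {\<delta> \<in> \<Omega>. rel \<alpha> \<delta> = rel \<alpha> \<gamma>} - {\<gamma>}"
  define B where "B \<delta> = {\<epsilon> \<in> \<Omega>. rel \<delta> \<epsilon> = rel \<gamma> \<epsilon>}" for \<delta>
  have fin: "finite A" "finite (B x)" for x
    unfolding A_def B_def using finite_points by auto
  have A: "card A \<le> k - 1"
    unfolding A_def using rel_right_card[OF assms] assms
    by (simp add: card_Diff_singleton diff_le_mono)
  have B: "card (B x) \<le> c" if "x \<in> A" for x
    unfolding B_def using that assms by (intro rel_right_eq_card) (auto simp: A_def)
  have "\<Omega> - determining \<alpha> \<gamma> \<subseteq> (\<Union>x\<in>A. B x)"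
    unfolding determining_def A_def B_def by auto
  then have "card (\<Omega> - determining \<alpha> \<gamma>) \<le> card (\<Union>x\<in>A. B x)"
    using fin by (intro card_mono) auto
  also have "\<dots> \<le> (\<Sum>x\<in>A. card (B x))" using fin by (intro card_UN_le)
  also have "\<dots> \<le> card A * c" using B sum_bounded_above[of A "\<lambda>y. card (B y)" c] by simp
  also have "\<dots> \<le> (k - 1) * c" using A by (rule mult_le_mono1)
  \<comment> \<open>The sharper bound is weakened to that of \<open>not_good_card\<close>, so that
    \<open>common_point\<close> treats both kinds of sets alike. For \<open>k = 0\<close> both sides
    vanish.\<close>
  also have "\<dots> \<le> c * k * (k - 1)" by (cases k) simp_all
  finally show ?thesis .
qed

text \<open>The factor 3 in \<open>large\<close> is spent here: three exceptional sets together do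
  not exhaust the points.\<close>

lemma common_point:
  assumes "card (\<Omega> - A) \<le> c * k * (k - 1)" "card (\<Omega> - B) \<le> c * k * (k - 1)"
    "card (\<Omega> - C) \<le> c * k * (k - 1)"
  obtains \<epsilon> where "\<epsilon> \<in> \<Omega>" "\<epsilon> \<in> A" "\<epsilon> \<in> B" "\<epsilon> \<in> C"
proof -
  have "card ((\<Omega> - A) \<union> (\<Omega> - B) \<union> (\<Omega> - C)) \<le> card (\<Omega> - A) + card (\<Omega> - B) + card (\<Omega> - C)"
    by (meson add_le_mono1 card_Un_le le_trans)
  also have "\<dots> < card \<Omega>" using assms large by (simp add: algebra_simps)
  finally have "(\<Omega> - A) \<union> (\<Omega> - B) \<union> (\<Omega> - C) \<noteq> \<Omega>" by auto
  then show thesis using that by blast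
qed

end

section \<open>Construction of the point map\<close>

locale bounded_algebraically_isomorphic =
  X: bounded_coherent \<Omega> S k c + algebraically_isomorphic \<Omega> S \<Omega>' S' \<phi>
  for \<Omega> :: "'a set" and S k c and \<Omega>' :: "'b set" and S' \<phi>
begin

lemma isomorphism_ex: "\<exists>f. cc_isomorphism f \<Omega> S \<Omega>' S' \<and> (\<forall>s \<in> S. \<phi> s = rel_image f s)"
proof -
  have ne: "\<Omega> \<noteq> {}" using X.large by auto
  then obtain \<alpha> where \<alpha>: "\<alpha> \<in> \<Omega>" by blast
  obtain \<alpha>' \<alpha>'' where "\<alpha>' \<in> \<Omega>'" "\<alpha>'' \<in> \<Omega>'" "X'.rel \<alpha>' \<alpha>'' = \<phi> (X.rel \<alpha> \<alpha>)"
    using X'.basis_nonempty[OF basis_image[OF X.rel_basis(1)[OF \<alpha> \<alpha>]]] by metis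
  then have \<alpha>': "\<alpha>' \<in> \<Omega>'" "X'.rel \<alpha>' \<alpha>' = \<phi> (X.rel \<alpha> \<alpha>)"
    using rel_diagonal_image \<alpha> by metis+
  \<comment> \<open>The point \<open>\<gamma>\<close> is chosen with maximal valency at
    \<open>\<alpha>\<close>, as \<open>unique_swap\<close> demands.\<close>
  define v where "v x = card (X.rel \<alpha> x `` {\<alpha>})" for x
  have "Max (v ` \<Omega>) \<in> v ` \<Omega>" using ne X.finite_points by (intro Max_in) auto
  then obtain \<gamma> where \<gamma>: "\<gamma> \<in> \<Omega>" "v \<gamma> = Max (v ` \<Omega>)" by auto
  have max: "v x \<le> v \<gamma>" if "x \<in> \<Omega>" for x
    unfolding \<gamma>(2) using that X.finite_points by (intro Max_ge) auto
  obtain \<gamma>' where \<gamma>': "\<gamma>' \<in> \<Omega>'" "X'.rel \<alpha>' \<gamma>' = \<phi> (X.rel \<alpha> \<gamma>)"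
    using transport_to[OF \<alpha> \<alpha> \<gamma>(1) \<alpha>'(1) \<alpha>'(1) \<alpha>'(2)] by metis
  \<comment> \<open>For these points, \<open>\<alpha>\<close> and \<open>\<epsilon>\<close>
    determine \<open>\<gamma>\<close>; after the swap, \<open>\<alpha>\<close> and
    \<open>\<gamma>\<close> determine \<open>\<epsilon>\<close>. So on \<open>E\<close> the images
    \<open>\<alpha>'\<close> and \<open>\<gamma>'\<close> leave only one choice for the map
    \<open>g\<close>.\<close>
  define E where "E = X.determining \<alpha> \<gamma>"
  have E: "\<epsilon> \<in> \<Omega>" if "\<epsilon> \<in> E" for \<epsilon> using that by (simp add: E_def X.determining_def)
  have cardE: "card (\<Omega> - E) \<le> c * k * (k - 1)"
    unfolding E_def by (rule X.not_determining_card[OF \<alpha> \<gamma>(1)])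
  have "\<exists>\<epsilon>' \<in> \<Omega>'. X'.rel \<alpha>' \<epsilon>' = \<phi> (X.rel \<alpha> \<epsilon>) \<and> X'.rel \<epsilon>' \<gamma>' = \<phi> (X.rel \<epsilon> \<gamma>)"
    if "\<epsilon> \<in> E" for \<epsilon>
    using transport_to[OF \<alpha> \<gamma>(1) E[OF that] \<alpha>'(1) \<gamma>'] by metis
  then obtain g where g: "\<And>\<epsilon>. \<epsilon> \<in> E \<Longrightarrow> g \<epsilon> \<in> \<Omega>'"
      "\<And>\<epsilon>. \<epsilon> \<in> E \<Longrightarrow> X'.rel \<alpha>' (g \<epsilon>) = \<phi> (X.rel \<alpha> \<epsilon>)"
      "\<And>\<epsilon>. \<epsilon> \<in> E \<Longrightarrow> X'.rel (g \<epsilon>) \<gamma>' = \<phi> (X.rel \<epsilon> \<gamma>)"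
    by metis
  have g_unique: "y = g \<epsilon>"
    if \<epsilon>: "\<epsilon> \<in> E" and y: "y \<in> \<Omega>'" "X'.rel \<alpha>' y = \<phi> (X.rel \<alpha> \<epsilon>)" "X'.rel y \<gamma>' = \<phi> (X.rel \<epsilon> \<gamma>)" for \<epsilon> y
  proof (rule transport_unique[OF \<alpha> \<gamma>(1) E[OF \<epsilon>] \<alpha>'(1) \<gamma>' _ y g[OF \<epsilon>]])
    fix \<delta> assume \<delta>: "\<delta> \<in> \<Omega>" "X.rel \<alpha> \<delta> = X.rel \<alpha> \<epsilon>" "X.rel \<delta> \<gamma> = X.rel \<epsilon> \<gamma>"
    show "\<delta> = \<epsilon>"
    proof (rule X.unique_swap[OF \<alpha> \<gamma>(1) E[OF \<epsilon>] _ _ \<delta>(1,2)])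
      show "card (X.rel \<alpha> \<epsilon> `` {\<alpha>}) \<le> card (X.rel \<alpha> \<gamma> `` {\<alpha>})"
        using max[OF E[OF \<epsilon>]] by (simp add: v_def)
      show "X.rel \<gamma> \<delta> = X.rel \<gamma> \<epsilon>" using X.rel_converse_eq_iff \<gamma>(1) \<delta> E[OF \<epsilon>] by blast
    qed (use \<epsilon> in \<open>simp add: E_def X.determining_def\<close>)
  qed
  \<comment> \<open>The auxiliary point \<open>\<zeta>\<close> is good for three triangles. With
    base from \<open>\<alpha>\<close> to \<open>\<gamma>\<close>, goodness shows that its image sees
    \<open>g \<epsilon>\<close> and \<open>g \<eta>\<close> in the right colours. With base from
    \<open>\<alpha>\<close> to \<open>\<eta>\<close>, it then yields the colour between
    \<open>g \<epsilon>\<close> and \<open>g \<eta>\<close>.\<close>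
  have g_rel: "X'.rel (g \<epsilon>) (g \<eta>) = \<phi> (X.rel \<epsilon> \<eta>)" if \<epsilon>: "\<epsilon> \<in> E" and \<eta>: "\<eta> \<in> E" for \<epsilon> \<eta>
  proof -
    obtain \<zeta> where \<zeta>: "\<zeta> \<in> \<Omega>" "\<zeta> \<in> X.good \<alpha> \<gamma> \<epsilon>" "\<zeta> \<in> X.good \<alpha> \<gamma> \<eta>" "\<zeta> \<in> X.good \<alpha> \<eta> \<epsilon>"
      using X.common_point X.not_good_card \<alpha> \<gamma>(1) E \<epsilon> \<eta> by metis
    obtain \<zeta>' where \<zeta>': "\<zeta>' \<in> \<Omega>'" "X'.rel \<alpha>' \<zeta>' = \<phi> (X.rel \<alpha> \<zeta>)" "X'.rel \<zeta>' \<gamma>' = \<phi> (X.rel \<zeta> \<gamma>)"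
      using transport_to[OF \<alpha> \<gamma>(1) \<zeta>(1) \<alpha>'(1) \<gamma>'] .
    have *: "X'.rel \<zeta>' (g x) = \<phi> (X.rel \<zeta> x)" if x: "x \<in> E" "\<zeta> \<in> X.good \<alpha> \<gamma> x" for x
    proof -
      obtain x' where x': "x' \<in> \<Omega>'" "X'.rel \<alpha>' x' = \<phi> (X.rel \<alpha> x)" "X'.rel x' \<zeta>' = \<phi> (X.rel x \<zeta>)"
        using transport_to[OF \<alpha> \<zeta>(1) E[OF x(1)] \<alpha>'(1) \<zeta>'(1,2)] .
      then have **: "X'.rel \<zeta>' x' = \<phi> (X.rel \<zeta> x)"
        using rel_converse_image E x \<zeta> \<zeta>' by metis
      have "X'.rel x' \<gamma>' = \<phi> (X.rel x \<gamma>)"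
        by (rule good_image[OF \<alpha> \<gamma>(1) E[OF x(1)] x(2) \<alpha>'(1) \<gamma>'(1) x'(1) \<zeta>'(1) \<gamma>'(2) x'(2) \<zeta>'(3) **])
      then have "x' = g x" using g_unique x x' by blast
      then show ?thesis using ** by simp
    qed
    show ?thesis
      by (rule good_image[OF \<alpha> E[OF \<eta>] E[OF \<epsilon>] \<zeta>(4) \<alpha>'(1) g(1)[OF \<eta>] g(1)[OF \<epsilon>] \<zeta>'(1)
            g(2)[OF \<eta>] g(2)[OF \<epsilon>] *[OF \<eta> \<zeta>(3)] *[OF \<epsilon> \<zeta>(2)]])
  qed
  \<comment> \<open>Extension to points outside \<open>E\<close>: some \<open>\<epsilon>\<close> in
    \<open>E\<close> determines \<open>\<delta>\<close> together with \<open>\<alpha>\<close>, which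
    fixes the candidate \<open>\<delta>'\<close>. To check it against another \<open>\<eta>\<close>
    in \<open>E\<close>, a second candidate \<open>y\<close> is built over a point
    \<open>\<zeta>\<close> of \<open>E\<close> that is good for both \<open>\<epsilon>\<close> and
    \<open>\<eta>\<close>. It has the right colour to both images, hence equals
    \<open>\<delta>'\<close>.\<close>
  have "\<exists>\<delta>' \<in> \<Omega>'. X'.rel \<alpha>' \<delta>' = \<phi> (X.rel \<alpha> \<delta>) \<and> (\<forall>\<eta> \<in> E. X'.rel (g \<eta>) \<delta>' = \<phi> (X.rel \<eta> \<delta>))"
    if \<delta>: "\<delta> \<in> \<Omega>" for \<delta>
  proof -
    obtain \<epsilon> where \<epsilon>: "\<epsilon> \<in> E" "\<epsilon> \<in> X.determining \<alpha> \<delta>"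
      \<comment> \<open>Only two conditions are imposed, so \<open>cardE\<close> fills the third
        place.\<close>
      using X.common_point[OF cardE X.not_determining_card[OF \<alpha> \<delta>] cardE] by metis
    obtain \<delta>' where \<delta>': "\<delta>' \<in> \<Omega>'" "X'.rel \<alpha>' \<delta>' = \<phi> (X.rel \<alpha> \<delta>)" "X'.rel \<delta>' (g \<epsilon>) = \<phi> (X.rel \<delta> \<epsilon>)"
      using transport_to[OF \<alpha> E[OF \<epsilon>(1)] \<delta> \<alpha>'(1) g(1,2)[OF \<epsilon>(1)]] .
    have "X'.rel (g \<eta>) \<delta>' = \<phi> (X.rel \<eta> \<delta>)" if \<eta>: "\<eta> \<in> E" for \<eta>
    proof -
      obtain \<zeta> where \<zeta>: "\<zeta> \<in> E" "\<zeta> \<in> X.good \<alpha> \<epsilon> \<delta>" "\<zeta> \<in> X.good \<alpha> \<eta> \<delta>"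
        using X.common_point[OF cardE X.not_good_card[OF \<alpha> E[OF \<epsilon>(1)] \<delta>]
            X.not_good_card[OF \<alpha> E[OF \<eta>] \<delta>]] by metis
      obtain y where y: "y \<in> \<Omega>'" "X'.rel \<alpha>' y = \<phi> (X.rel \<alpha> \<delta>)" "X'.rel y (g \<zeta>) = \<phi> (X.rel \<delta> \<zeta>)"
        using transport_to[OF \<alpha> E[OF \<zeta>(1)] \<delta> \<alpha>'(1) g(1,2)[OF \<zeta>(1)]] .
      then have *: "X'.rel (g \<zeta>) y = \<phi> (X.rel \<zeta> \<delta>)"
        using rel_converse_image E \<delta> \<zeta> g by metis
      have "X'.rel y (g \<epsilon>) = \<phi> (X.rel \<delta> \<epsilon>)"
        by (rule good_image[OF \<alpha> E[OF \<epsilon>(1)] \<delta> \<zeta>(2) \<alpha>'(1) g(1)[OF \<epsilon>(1)] y(1) g(1)[OF \<zeta>(1)]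
              g(2)[OF \<epsilon>(1)] y(2) g_rel[OF \<zeta>(1) \<epsilon>(1)] *])
      then have "y = \<delta>'"
        using transport_unique[OF \<alpha> E[OF \<epsilon>(1)] \<delta> \<alpha>'(1) g(1,2)[OF \<epsilon>(1)] _ y(1,2) _ \<delta>'] \<epsilon>(2)
        by (simp add: X.determining_def)
      moreover have "X'.rel y (g \<eta>) = \<phi> (X.rel \<delta> \<eta>)"
        by (rule good_image[OF \<alpha> E[OF \<eta>] \<delta> \<zeta>(3) \<alpha>'(1) g(1)[OF \<eta>] y(1) g(1)[OF \<zeta>(1)]
              g(2)[OF \<eta>] y(2) g_rel[OF \<zeta>(1) \<eta>] *])
      ultimately show ?thesis using rel_converse_image \<delta> E[OF \<eta>] \<delta>'(1) g(1)[OF \<eta>] by metis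
    qed
    then show ?thesis using \<delta>' by blast
  qed
  then obtain f where f: "\<And>\<delta>. \<delta> \<in> \<Omega> \<Longrightarrow> f \<delta> \<in> \<Omega>'"
      "\<And>\<delta>. \<delta> \<in> \<Omega> \<Longrightarrow> X'.rel \<alpha>' (f \<delta>) = \<phi> (X.rel \<alpha> \<delta>)"
      "\<And>\<delta> \<eta>. \<delta> \<in> \<Omega> \<Longrightarrow> \<eta> \<in> E \<Longrightarrow> X'.rel (g \<eta>) (f \<delta>) = \<phi> (X.rel \<eta> \<delta>)"
    by metis
  \<comment> \<open>The colours from \<open>\<alpha>'\<close> and from \<open>g \<zeta>\<close> to
    the values of \<open>f\<close> are known, so one good \<open>\<zeta>\<close> in \<open>E\<close>
    closes the triangle.\<close>
  have f_rel: "X'.rel (f \<delta>) (f \<beta>) = \<phi> (X.rel \<delta> \<beta>)" if \<delta>: "\<delta> \<in> \<Omega>" and \<beta>: "\<beta> \<in> \<Omega>" for \<delta> \<beta>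
  proof -
    obtain \<zeta> where \<zeta>: "\<zeta> \<in> E" "\<zeta> \<in> X.good \<alpha> \<beta> \<delta>"
      using X.common_point[OF cardE X.not_good_card[OF \<alpha> \<beta> \<delta>] cardE] by metis
    show ?thesis
      by (rule good_image[OF \<alpha> \<beta> \<delta> \<zeta>(2) \<alpha>'(1) f(1)[OF \<beta>] f(1)[OF \<delta>] g(1)[OF \<zeta>(1)]
            f(2)[OF \<beta>] f(2)[OF \<delta>] f(3)[OF \<beta> \<zeta>(1)] f(3)[OF \<delta> \<zeta>(1)]])
  qed
  show ?thesis by (intro exI[of _ f] isomorphism_if_rel f(1) f_rel ne)
qed

end

theorem (in bounded_coherent) bounded_separable: "separable TYPE('b) \<Omega> S"
  unfolding separable_def
proof (intro allI impI)
  fix \<Omega>' :: "'b set" and S' and \<phi> :: "'a rel \<Rightarrow> 'b rel"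
  assume "coherent_configuration \<Omega>' S' \<and> algebraic_isomorphism \<phi> S S'"
  then interpret bounded_algebraically_isomorphic \<Omega> S k c \<Omega>' S' \<phi>
    by unfold_locales auto
  show "\<exists>f. cc_isomorphism f \<Omega> S \<Omega>' S' \<and> (\<forall>s \<in> S. \<phi> s = rel_image f s)"
    by (rule isomorphism_ex)
qed

section \<open>Automorphisms of finite fields\<close>

lemma (in cring) binomial:
  assumes [simp]: "x \<in> carrier R" "y \<in> carrier R"
  shows "(x \<oplus> y) [^] (n::nat) = (\<Oplus>i\<in>{..n}. [(n choose i)] \<cdot> (x [^] i \<otimes> y [^] (n - i)))"
proof (induction n)
  case 0
  show ?case by simp
next
  case (Suc n)
  \<comment> \<open>Here \<open>s i\<close> is \<open>t i\<close> times \<open>y\<close> for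
    \<open>i \<le> n\<close> and vanishes at \<open>Suc n\<close>. Pascal's rule becomes
    \<open>u (Suc i) = x \<otimes> t i \<oplus> s (Suc i)\<close>.\<close>
  define t where "t i = [(n choose i)] \<cdot> (x [^] i \<otimes> y [^] (n - i))" for i
  define s where "s i = [(n choose i)] \<cdot> (x [^] i \<otimes> y [^] (Suc n - i))" for i
  define u where "u i = [(Suc n choose i)] \<cdot> (x [^] i \<otimes> y [^] (Suc n - i))" for i
  have [simp]: "t i \<in> carrier R" "s i \<in> carrier R" "u i \<in> carrier R" for i
    by (simp_all add: t_def s_def u_def)
  have u0: "u 0 = s 0" by (simp add: u_def s_def)
  have u_Suc: "u (Suc i) = x \<otimes> t i \<oplus> s (Suc i)" for i
  proof -
    have "x \<otimes> t i = [(n choose i)] \<cdot> (x [^] Suc i \<otimes> y [^] (n - i))"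
      unfolding t_def by (subst add_pow_rdistr) (simp_all add: m_ac)
    then show ?thesis by (simp add: u_def s_def add.nat_pow_mult)
  qed
  have ys: "s i = t i \<otimes> y" if "i \<le> n" for i
  proof -
    have "y [^] (Suc n - i) = y [^] (n - i) \<otimes> y" using that by (simp add: Suc_diff_le)
    then show ?thesis unfolding s_def t_def
      by (subst add_pow_ldistr) (simp_all add: m_ac)
  qed
  have sn: "s (Suc n) = \<zero>" by (simp add: s_def binomial_eq_0)
  have "(x \<oplus> y) [^] Suc n = (\<Oplus>i\<in>{..n}. t i) \<otimes> (x \<oplus> y)"
    using Suc by (simp add: t_def)
  also have "\<dots> = x \<otimes> (\<Oplus>i\<in>{..n}. t i) \<oplus> (\<Oplus>i\<in>{..n}. t i) \<otimes> y"
    using m_comm[of x "\<Oplus>i\<in>{..n}. t i"] by (simp add: r_distr)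
  also have "x \<otimes> (\<Oplus>i\<in>{..n}. t i) = (\<Oplus>i\<in>{..n}. x \<otimes> t i)"
    by (intro finsum_rdistr) auto
  also have "(\<Oplus>i\<in>{..n}. t i) \<otimes> y = (\<Oplus>i\<in>{..n}. t i \<otimes> y)"
    by (intro finsum_ldistr) auto
  also have "\<dots> = (\<Oplus>i\<in>{..n}. s i)"
    by (intro finsum_cong') (auto simp: ys)
  also have "\<dots> = (\<Oplus>i\<in>{..Suc n}. s i)"
    by (subst finsum_Suc) (auto simp: sn)
  also have "\<dots> = (\<Oplus>i\<in>{..n}. s (Suc i)) \<oplus> s 0"
    by (subst finsum_Suc2) auto
  also have "(\<Oplus>i\<in>{..n}. x \<otimes> t i) \<oplus> ((\<Oplus>i\<in>{..n}. s (Suc i)) \<oplus> s 0) = (\<Oplus>i\<in>{..n}. u (Suc i)) \<oplus> u 0"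
    by (simp add: u_Suc u0 finsum_addf a_assoc)
  also have "\<dots> = (\<Oplus>i\<in>{..Suc n}. u i)"
    by (subst finsum_Suc2) auto
  finally show ?case by (simp add: u_def)
qed

lemma (in cring) add_pow_multiple_eq_zero:
  assumes "[p] \<cdot> \<one> = \<zero>" "p dvd n" "x \<in> carrier R"
  shows "[(n::nat)] \<cdot> x = \<zero>"
proof -
  obtain m where m: "n = p * m" using assms(2) by blast
  have "[p] \<cdot> x = ([p] \<cdot> \<one>) \<otimes> x" using assms(3) by (subst add_pow_ldistr) auto
  then have "[p] \<cdot> x = \<zero>" using assms by simp
  then have "[m] \<cdot> ([p] \<cdot> x) = \<zero>" by simp
  then show ?thesis using assms(3) m by (simp add: add.nat_pow_pow)
qed

lemma (in cring) frobenius_add: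
  assumes "Factorial_Ring.prime p" "[p] \<cdot> \<one> = \<zero>" and [simp]: "x \<in> carrier R" "y \<in> carrier R"
  shows "(x \<oplus> y) [^] (p::nat) = x [^] p \<oplus> y [^] p"
proof -
  obtain q where p: "p = Suc q" and q: "q \<noteq> 0"
    using prime_gt_1_nat[OF assms(1)] by (cases p) auto
  \<comment> \<open>Writing \<open>p\<close> as a double successor lets both end terms be split off.
    The indices that remain run from 1 to \<open>p - 1\<close>, where \<open>p\<close> divides the
    binomial coefficient.\<close>
  obtain r where r: "q = Suc r" using q by (cases q) auto
  define t where "t i = [(p choose i)] \<cdot> (x [^] i \<otimes> y [^] (p - i))" for i
  have [simp]: "t i \<in> carrier R" for i by (simp add: t_def)
  have z: "t (Suc i) = \<zero>" if "i \<le> r" for i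
  proof -
    have "p dvd p choose Suc i"
      using assms(1) that p r by (intro dvd_choose_prime) auto
    then show ?thesis unfolding t_def by (intro add_pow_multiple_eq_zero[OF assms(2)]) auto
  qed
  have "(x \<oplus> y) [^] p = (\<Oplus>i\<in>{..p}. t i)" by (simp add: binomial t_def)
  also have "\<dots> = t p \<oplus> (\<Oplus>i\<in>{..q}. t i)" unfolding p by (subst finsum_Suc) auto
  also have "(\<Oplus>i\<in>{..q}. t i) = (\<Oplus>i\<in>{..r}. t (Suc i)) \<oplus> t 0"
    unfolding r by (subst finsum_Suc2) auto
  also have "(\<Oplus>i\<in>{..r}. t (Suc i)) = (\<Oplus>i\<in>{..r}. \<zero>)"
    by (intro finsum_cong') (auto simp: z)
  finally show ?thesis by (simp add: t_def)
qed

lemma (in cring) frobenius_hom: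
  assumes "Factorial_Ring.prime p" "[p] \<cdot> \<one> = \<zero>"
  shows "(\<lambda>x. x [^] ((p::nat) ^ j)) \<in> ring_hom R R"
proof (induction j)
  case 0
  show ?case by (simp add: ring_hom_def Pi_def)
next
  case (Suc j)
  show ?case
  proof (rule ring_hom_memI)
    fix x y assume [simp]: "x \<in> carrier R" "y \<in> carrier R"
    have pow: "z [^] (p ^ Suc j) = (z [^] (p ^ j)) [^] p" if "z \<in> carrier R" for z
      using that by (simp add: nat_pow_pow mult.commute)
    show "(x \<oplus> y) [^] (p ^ Suc j) = x [^] (p ^ Suc j) \<oplus> y [^] (p ^ Suc j)"
      using ring_hom_add[OF Suc, of x y] by (simp add: pow frobenius_add[OF assms] del: power_Suc)
    show "(x \<otimes> y) [^] (p ^ Suc j) = x [^] (p ^ Suc j) \<otimes> y [^] (p ^ Suc j)"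
      by (simp add: nat_pow_distrib)
  qed auto
qed

text \<open>The coefficients, cut off after \<open>n\<close>, form a nonzero element of
  \<open>UP R\<close> of degree at most \<open>n\<close>. The nonzero coefficient may sit at any
  \<open>j\<close>, so the degree itself may be smaller.\<close>

lemma (in domain) finsum_roots_card:
  assumes "finite (carrier R)" "\<And>i. c i \<in> carrier R" "j \<le> n" "c j \<noteq> \<zero>"
  shows "card {x \<in> carrier R. (\<Oplus>i\<in>{..n}. c i \<otimes> x [^] i) = \<zero>} \<le> n"
proof -
  interpret U: UP_domain R "UP R" by unfold_locales
  define f where "f i = (if i \<le> n then c i else \<zero>)" for i
  have f: "f \<in> up R"
    by (rule mem_upI) (auto simp: f_def assms bound_def intro!: exI[of _ n])
  then have fc: "f \<in> carrier (UP R)" by (simp add: UP_def)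
  have coeff: "coeff (UP R) f i = f i" for i using f by (simp add: UP_def)
  have ne: "f \<noteq> \<zero>\<^bsub>UP R\<^esub>"
  proof
    assume "f = \<zero>\<^bsub>UP R\<^esub>"
    then have "f j = \<zero>" by (simp add: UP_def)
    then show False using assms by (simp add: f_def)
  qed
  have deg: "deg R f \<le> n" by (rule U.deg_aboveI[OF _ fc]) (simp add: coeff f_def)
  have ev: "eval R R id x f = (\<Oplus>i\<in>{..n}. c i \<otimes> x [^] i)" if x: "x \<in> carrier R" for x
  proof -
    have "eval R R id x f = (\<Oplus>i\<in>{..deg R f}. f i \<otimes> x [^] i)"
      using fc by (simp add: eval_def coeff)
    also have "\<dots> = (\<Oplus>i\<in>{..n}. f i \<otimes> x [^] i)"
    proof (rule add.finprod_mono_neutral_cong_left)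
      fix i assume "i \<in> {..n} - {..deg R f}"
      then have "f i = \<zero>" using U.deg_aboveD[OF _ fc, of i] by (simp add: coeff)
      then show "f i \<otimes> x [^] i = \<zero>" using x by simp
    qed (use deg x assms in \<open>auto simp: f_def\<close>)
    also have "\<dots> = (\<Oplus>i\<in>{..n}. c i \<otimes> x [^] i)"
      by (intro finsum_cong') (auto simp: f_def assms x)
    finally show ?thesis .
  qed
  have "{x \<in> carrier R. (\<Oplus>i\<in>{..n}. c i \<otimes> x [^] i) = \<zero>} = {x \<in> carrier R. eval R R id x f = \<zero>}"
    using ev by auto
  then show ?thesis using U.roots_bound[OF fc ne assms(1)] deg by simp
qed

text \<open>Multiples of one are fixed by ring endomorphisms. Hence an endomorphism sends roots of a
  polynomial with such coefficients to roots of the same polynomial.\<close>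

lemma (in ring) ring_hom_nat:
  assumes "h \<in> ring_hom R R"
  shows "h ([(n::nat)] \<cdot> \<one>) = [n] \<cdot> \<one>"
proof (induction n)
  case 0
  then show ?case using ring_hom_zero[OF assms ring_axioms ring_axioms] by simp
next
  case (Suc n)
  then show ?case
    using ring_hom_add[OF assms, of "[n] \<cdot> \<one>" \<one>] ring_hom_one[OF assms] by simp
qed

text \<open>Lagrange's theorem in the additive group kills \<open>p ^ d\<close> times one. This
  element is the \<open>d\<close>-th power of \<open>p\<close> times one, and a field has no nonzero
  nilpotents.\<close>

lemma (in field) characteristic_prime_power:
  assumes "order R = p ^ d"
  shows "[(p::nat)] \<cdot> \<one> = \<zero>"
proof -
  have "\<one> [^]\<^bsub>add_monoid R\<^esub> order (add_monoid R) = \<one>\<^bsub>add_monoid R\<^esub>"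
    by (rule group.pow_order_eq_1) (simp_all add: add.is_group)
  then have 1: "[(p ^ d)] \<cdot> \<one> = \<zero>" using assms by (simp add: add_pow_def order_def)
  have "([p] \<cdot> \<one>) [^] n = [(p ^ n)] \<cdot> \<one>" for n
  proof (induction n)
    case (Suc n)
    then have "([p] \<cdot> \<one>) [^] Suc n = [(p ^ n)] \<cdot> ([p] \<cdot> \<one>)"
      by (simp add: add_pow_ldistr)
    then show ?case by (simp add: add.nat_pow_pow)
  qed simp
  then have "([p] \<cdot> \<one>) [^] d = \<zero>" using 1 by simp
  moreover have "x = \<zero>" if "x \<in> carrier R" "x [^] n = \<zero>" for x and n :: nat
    using that by (induction n) (auto simp: integral_iff)
  ultimately show ?thesis by simp
qed

text \<open>The additive order of one divides the prime \<open>p\<close> and is not 1, so it is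
  \<open>p\<close>.\<close>

lemma (in field) nat_multiple_one_inj:
  assumes "Factorial_Ring.prime p" "[(p::nat)] \<cdot> \<one> = \<zero>" "a < p" "b < p" "[(a::nat)] \<cdot> \<one> = [(b::nat)] \<cdot> \<one>"
  shows "a = b"
proof -
  have "add.ord \<one> dvd p" using assms(2) by (simp add: add.pow_eq_id)
  moreover have "add.ord \<one> \<noteq> 1" using add.ord_eq_1[of \<one>] by simp
  ultimately have "add.ord \<one> = p" using assms(1) by (metis prime_nat_iff)
  then show ?thesis using add.ord_inj[of \<one>] assms(3-5) by (auto simp: inj_on_def)
qed

text \<open>A generator \<open>g\<close> of the multiplicative group is a root of a nonzero
  polynomial of degree at most \<open>d\<close> over the prime field, by the pigeonhole principle.
  Its \<open>d\<close> Frobenius conjugates are distinct and therefore are all the roots. As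
  \<open>\<sigma> g\<close> is a root as well, it is one of them, and \<open>\<sigma>\<close> is
  determined by its value at \<open>g\<close>.\<close>

lemma (in field) prime_power_field_automorphism:
  assumes p: "Factorial_Ring.prime p" and order: "order R = p ^ d" and \<sigma>: "\<sigma> \<in> ring_hom R R"
  obtains i where "i < d" "\<And>x. x \<in> carrier R \<Longrightarrow> \<sigma> x = x [^] ((p::nat) ^ i)"
proof -
  have char: "[p] \<cdot> \<one> = \<zero>" by (rule characteristic_prime_power[OF order])
  have card: "card (carrier R) = p ^ d" using order by (simp add: order_def)
  have fin: "finite (carrier R)"
    using card prime_gt_0_nat[OF p] by (intro card_ge_0_finite) simp
  interpret G: group "mult_of R" by (rule field_mult_group)
  obtain g where g: "g \<in> carrier (mult_of R)" "carrier (mult_of R) = {g [^] i |i::nat. i \<in> UNIV}"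
    using finite_field_mult_group_has_gen[OF fin] by blast
  have gc: "g \<in> carrier R" "g \<noteq> \<zero>" using g(1) by auto
  have "G.ord g = order (mult_of R)"
  proof -
    have "carrier (mult_of R) = generate (mult_of R) {g}"
      using g(2) G.generate_pow_nat[OF g(1)] G.ord_ge_1[OF finite_mult_of[OF fin] g(1)]
      by (simp add: nat_pow_mult_of)
    then show ?thesis using G.generate_pow_card[OF g(1)] by (simp add: order_def)
  qed
  then have ord: "G.ord g = p ^ d - 1" using order_mult_of[OF fin] order by simp
  have pow_inj: "a = b" if "a < p ^ d" "b < p ^ d" "0 < a" "0 < b" "g [^] a = g [^] b" for a b :: nat
    using G.ord_inj'[OF g(1)] that by (auto simp: ord inj_on_def nat_pow_mult_of)
  \<comment> \<open>There are \<open>p ^ (d + 1)\<close> coefficient vectors and only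
    \<open>p ^ d\<close> field elements, so two vectors give the same value at \<open>g\<close>.
    Their difference \<open>c\<close> is the desired polynomial.\<close>
  define P where "P = {..d} \<rightarrow>\<^sub>E {..<p}"
  define ev where "ev a x = (\<Oplus>i\<in>{..d}. ([(a i :: nat)] \<cdot> \<one>) \<otimes> x [^] i)" for a x
  have "card P = p ^ (d + 1)" by (simp add: P_def card_PiE)
  moreover have "p ^ d < p ^ (d + 1)" using prime_gt_1_nat[OF p] by simp
  moreover have "(\<lambda>a. ev a g) ` P \<subseteq> carrier R" by (auto simp: ev_def gc)
  ultimately have "\<not> inj_on (\<lambda>a. ev a g) P"
    using card_inj_on_le[of "\<lambda>a. ev a g" P "carrier R"] fin card by auto
  then obtain a b where ab: "a \<in> P" "b \<in> P" "a \<noteq> b" "ev a g = ev b g"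
    by (auto simp: inj_on_def)
  then obtain j where j: "j \<le> d" "a j \<noteq> b j" unfolding P_def by (metis PiE_ext atMost_iff)
  define c where "c i = [a i] \<cdot> \<one> \<ominus> [b i] \<cdot> \<one>" for i
  have c: "c i \<in> carrier R" for i by (simp add: c_def)
  have cj: "c j \<noteq> \<zero>"
    using nat_multiple_one_inj[OF p char, of "a j" "b j"] ab j
    by (auto simp: c_def P_def PiE_iff)
  have root: "(\<Oplus>i\<in>{..d}. c i \<otimes> h g [^] i) = \<zero>" if h: "h \<in> ring_hom R R" for h
  proof -
    interpret h: ring_hom_cring R R h
      by (intro ring_hom_cring.intro ring_hom_cring_axioms.intro is_cring h)
    have "ev a g = (\<Oplus>i\<in>{..d}. c i \<otimes> g [^] i \<oplus> ([b i] \<cdot> \<one>) \<otimes> g [^] i)"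
      unfolding ev_def
      by (intro finsum_cong') (auto simp: c gc c_def a_minus_def a_assoc l_neg simp flip: l_distr)
    also have "\<dots> = (\<Oplus>i\<in>{..d}. c i \<otimes> g [^] i) \<oplus> ev b g"
      unfolding ev_def by (intro finsum_addf) (auto simp: c gc)
    finally have "\<zero> = (\<Oplus>i\<in>{..d}. c i \<otimes> g [^] i)"
      using ab(4) c gc by (simp add: ev_def Pi_def)
    then have "\<zero> = h (\<Oplus>i\<in>{..d}. c i \<otimes> g [^] i)" using h.hom_zero by simp
    also have "\<dots> = (\<Oplus>i\<in>{..d}. c i \<otimes> h g [^] i)"
      by (subst h.hom_finsum)
        (auto simp: c gc c_def ring_hom_nat[OF h] a_minus_def intro!: finsum_cong')
    finally show ?thesis by simp
  qed
  define Z where "Z = {x \<in> carrier R. (\<Oplus>i\<in>{..d}. c i \<otimes> x [^] i) = \<zero>}"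
  have Z: "card Z \<le> d" "finite Z"
    using finsum_roots_card[where c = c, OF fin c j(1) cj] fin by (auto simp: Z_def)
  define A where "A = (\<lambda>i. g [^] (p ^ i)) ` {..<d}"
  have pd: "p ^ i < p ^ d" if "i < d" for i
    using that prime_gt_1_nat[OF p] by (intro power_strict_increasing) auto
  have "inj_on (\<lambda>i. g [^] (p ^ i)) {..<d}"
  proof (rule inj_onI)
    fix i k assume "i \<in> {..<d}" "k \<in> {..<d}" "g [^] (p ^ i) = g [^] (p ^ k)"
    then have "p ^ i = p ^ k" using pow_inj pd prime_gt_0_nat[OF p] by simp
    then show "i = k" using prime_gt_1_nat[OF p] by simp
  qed
  then have cardA: "card A = d" by (simp add: A_def card_image)
  have "A \<subseteq> Z" using root[OF frobenius_hom[OF p char]] gc by (auto simp: A_def Z_def)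
  \<comment> \<open>The conjugates already attain the bound \<open>d\<close> on the number of
    roots.\<close>
  then have "A = Z" using Z cardA by (intro card_seteq) auto
  moreover have "\<sigma> g \<in> Z" using root[OF \<sigma>] ring_hom_closed[OF \<sigma>] gc by (simp add: Z_def)
  ultimately obtain i where i: "i < d" "\<sigma> g = g [^] (p ^ i)" by (auto simp: A_def)
  interpret s: ring_hom_cring R R \<sigma>
    by (intro ring_hom_cring.intro ring_hom_cring_axioms.intro is_cring \<sigma>)
  show thesis
  proof (rule that[OF i(1)])
    fix x assume x: "x \<in> carrier R"
    show "\<sigma> x = x [^] (p ^ i)"
    proof (cases "x = \<zero>")
      case True
      then show ?thesis using prime_gt_0_nat[OF p] by (simp add: nat_pow_zero)
    next
      case False
      then have "x \<in> carrier (mult_of R)" using x by simp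
      then obtain k :: nat where "x = g [^] k" using g(2) by auto
      then show ?thesis using i gc by (simp add: nat_pow_pow mult.commute)
    qed
  qed
qed

lemma (in field) prime_power_field_pow_order:
  assumes "Factorial_Ring.prime p" "order R = p ^ d" "x \<in> carrier R"
  shows "x [^] ((p::nat) ^ d) = x"
proof (cases "x = \<zero>")
  case True
  then show ?thesis using prime_gt_0_nat[OF assms(1)] by (simp add: nat_pow_zero)
next
  case False
  have fin: "finite (carrier R)"
    using assms(2) prime_gt_0_nat[OF assms(1)] by (intro card_ge_0_finite) (simp add: order_def)
  interpret G: group "mult_of R" by (rule field_mult_group)
  have "x [^] (p ^ d - 1) = \<one>"
    using G.pow_order_eq_1[of x] False assms order_mult_of[OF fin] by (simp add: nat_pow_mult_of)
  then have "x [^] Suc (p ^ d - 1) = x" using assms(3) by simp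
  then show ?thesis using prime_gt_0_nat[OF assms(1)] by simp
qed

text \<open>The quotient of two solutions is fixed by the power \<open>p ^ m\<close>, and like every
  element by the power \<open>p ^ d\<close>, hence by the power \<open>p ^ gcd m d\<close>. Dividing
  by one solution \<open>w0\<close> thus embeds the solutions into the roots of unity of order
  dividing \<open>p ^ gcd m d - 1\<close>.\<close>

lemma (in field) frobenius_eigenspace_card:
  assumes p: "Factorial_Ring.prime p" and order: "order R = p ^ d"
    and m: "0 < m" and b: "b \<in> carrier R"
  shows "card {w \<in> carrier R - {\<zero>}. w [^] ((p::nat) ^ m) = b \<otimes> w} \<le> p ^ gcd m d - 1"
proof -
  define W where "W = {w \<in> carrier R - {\<zero>}. w [^] (p ^ m) = b \<otimes> w}"
  define V where "V = {v \<in> carrier R. v [^] (p ^ gcd m d - 1) = \<one>}"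
  have fin: "finite (carrier R)"
    using order prime_gt_0_nat[OF p] by (intro card_ge_0_finite) (simp add: order_def)
  have iter: "v [^] (p ^ (k * a)) = v" if "v \<in> carrier R" "v [^] (p ^ k) = v" for v k a
  proof (induction a)
    case (Suc a)
    have "v [^] (p ^ (k * Suc a)) = (v [^] (p ^ k)) [^] (p ^ (k * a))"
      using that(1) by (simp add: nat_pow_pow power_add)
    then show ?case using Suc that by simp
  qed (use that in simp)
  have V: "v \<in> V" if v: "v \<in> carrier R" "v \<noteq> \<zero>" "v [^] (p ^ m) = v" for v
  proof -
    \<comment> \<open>Bezout's identity in natural numbers; \<open>m\<close> must be
      nonzero.\<close>
    obtain a c where ac: "m * a = d * c + gcd m d" using bezout_nat[of m d] m by auto
    have "v = v [^] (p ^ (m * a))" using iter v by simp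
    also have "\<dots> = (v [^] (p ^ (d * c))) [^] (p ^ gcd m d)"
      using v by (simp add: ac power_add nat_pow_pow)
    also have "\<dots> = v [^] (p ^ gcd m d)"
      using iter prime_power_field_pow_order[OF p order] v by simp
    also have "p ^ gcd m d = Suc (p ^ gcd m d - 1)" using prime_gt_0_nat[OF p] by simp
    finally have "v [^] (p ^ gcd m d - 1) \<otimes> v = \<one> \<otimes> v" using v by simp
    then have "v [^] (p ^ gcd m d - 1) = \<one>" using v m_rcancel[of v _ \<one>] by blast
    then show ?thesis using v by (simp add: V_def)
  qed
  have "1 < p ^ gcd m d" using prime_gt_1_nat[OF p] m by (intro one_less_power) auto
  then have cardV: "card V \<le> p ^ gcd m d - 1"
    unfolding V_def by (intro num_roots_le_deg[OF fin]) simp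
  have "card W \<le> card V"
  proof (cases "W = {}")
    case False
    then obtain w0 where w0: "w0 \<in> carrier R" "w0 \<noteq> \<zero>" "w0 [^] (p ^ m) = b \<otimes> w0"
      by (auto simp: W_def)
    have u: "w0 \<in> Units R" using w0 by (simp add: field_Units)
    then have i: "inv w0 \<in> carrier R" "inv w0 \<noteq> \<zero>" "w0 \<otimes> inv w0 = \<one>"
      using Units_inv_Units[OF u] by (auto simp: field_Units)
    show ?thesis
    proof (rule card_inj_on_le)
      show "inj_on (\<lambda>w. w \<otimes> inv w0) W"
        using i m_rcancel[of "inv w0"] by (auto simp: inj_on_def W_def)
      show "(\<lambda>w. w \<otimes> inv w0) ` W \<subseteq> V"
      proof
        fix v assume "v \<in> (\<lambda>w. w \<otimes> inv w0) ` W"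
        then obtain w where w: "w \<in> carrier R" "w \<noteq> \<zero>" "w [^] (p ^ m) = b \<otimes> w" "v = w \<otimes> inv w0"
          by (auto simp: W_def)
        then have v: "v \<in> carrier R" "v \<noteq> \<zero>" "w = v \<otimes> w0"
          using i w0 by (auto simp: integral_iff m_assoc m_comm[of "inv w0"])
        have "v [^] (p ^ m) \<otimes> (b \<otimes> w0) = v \<otimes> (b \<otimes> w0)"
          using w(3) v w0 b by (simp add: nat_pow_distrib m_ac)
        moreover have "b \<otimes> w0 \<noteq> \<zero>"
          using w0 by (metis Units_pow_closed field_Units Diff_iff insertI1 u)
        ultimately have "v [^] (p ^ m) = v" using v b w0 m_rcancel[of "b \<otimes> w0"] by simp
        then show "v \<in> V" using V v by blast
      qed
      show "finite V" using fin by (simp add: V_def)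
    qed
  qed simp
  then show ?thesis using cardV by (simp add: W_def)
qed

section \<open>Valencies and indistinguishing numbers of the scheme\<close>

text \<open>The quotient of the two entries of a pair in the relation of \<open>x\<close> and
  \<open>y\<close> does not depend on the multiplier: it is a Frobenius conjugate of
  \<open>u = y / x\<close>. So a first entry leaves at most \<open>d\<close> second entries.\<close>

lemma (in field) C_basis_pair:
  assumes p: "Factorial_Ring.prime p" and order: "order R = p ^ d" and r: "r \<in> C_basis R"
  obtains u where "u \<in> carrier R - {\<zero>}"
    "\<And>\<alpha> \<beta>. (\<alpha>, \<beta>) \<in> r \<Longrightarrow> \<exists>i<d. \<beta> = \<alpha> \<otimes> u [^] ((p::nat) ^ i)"
proof -
  obtain x y where xy: "x \<in> carrier R - {\<zero>}" "y \<in> carrier R - {\<zero>}"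
    and r: "r = {(a \<otimes> \<sigma> x, a \<otimes> \<sigma> y) | a \<sigma>. a \<in> carrier R - {\<zero>} \<and> \<sigma> \<in> ring_iso R R}"
    using r unfolding C_basis_def by blast
  have ux: "x \<in> Units R" using xy by (simp add: field_Units)
  then have i: "inv x \<in> carrier R" "inv x \<noteq> \<zero>" "x \<otimes> inv x = \<one>"
    using Units_inv_Units[OF ux] by (auto simp: field_Units)
  define u where "u = y \<otimes> inv x"
  have u: "u \<in> carrier R" "u \<noteq> \<zero>" "y = x \<otimes> u"
    using xy i m_lcomm[of x y "inv x"] by (auto simp: u_def integral_iff)
  show thesis
  proof (rule that)
    show "u \<in> carrier R - {\<zero>}" using u by simp
    fix \<alpha> \<beta> assume "(\<alpha>, \<beta>) \<in> r"
    then obtain a \<sigma> where a: "a \<in> carrier R - {\<zero>}" "\<sigma> \<in> ring_iso R R" "\<alpha> = a \<otimes> \<sigma> x" "\<beta> = a \<otimes> \<sigma> y"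
      unfolding r by blast
    have \<sigma>: "\<sigma> \<in> ring_hom R R" using a(2) by (simp add: ring_iso_def)
    obtain i where i: "i < d" "\<And>x. x \<in> carrier R \<Longrightarrow> \<sigma> x = x [^] (p ^ i)"
      using prime_power_field_automorphism[OF p order \<sigma>] by blast
    have "\<sigma> y = \<sigma> x \<otimes> u [^] (p ^ i)"
      using i(2)[OF u(1)] u xy ring_hom_mult[OF \<sigma>, of x u] by simp
    then have "\<beta> = \<alpha> \<otimes> u [^] (p ^ i)"
      using a u xy ring_hom_closed[OF \<sigma>, of x] by (simp add: m_assoc)
    then show "\<exists>i<d. \<beta> = \<alpha> \<otimes> u [^] (p ^ i)" using i(1) by blast
  qed
qed

lemma (in field) C_basis_valency:
  assumes "Factorial_Ring.prime p" "order R = (p::nat) ^ d" "r \<in> C_basis R"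
  shows "card (r `` {\<alpha>}) \<le> d" "finite (r `` {\<alpha>})"
proof -
  obtain u where "\<And>\<alpha> \<beta>. (\<alpha>, \<beta>) \<in> r \<Longrightarrow> \<exists>i<d. \<beta> = \<alpha> \<otimes> u [^] (p ^ i)"
    using C_basis_pair[OF assms] by metis
  then have sub: "r `` {\<alpha>} \<subseteq> (\<lambda>i. \<alpha> \<otimes> u [^] (p ^ i)) ` {..<d}" by blast
  then show "finite (r `` {\<alpha>})" by (rule finite_subset) simp
  have "card (r `` {\<alpha>}) \<le> card ((\<lambda>i. \<alpha> \<otimes> u [^] (p ^ i)) ` {..<d})"
    using sub by (intro card_mono) auto
  also have "\<dots> \<le> d" using card_image_le[of "{..<d}"] by simp
  finally show "card (r `` {\<alpha>}) \<le> d" .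
qed

text \<open>If \<open>\<gamma>\<close> sees \<open>\<alpha>\<close> and \<open>\<beta>\<close> in
  one relation, then \<open>\<alpha> / \<gamma>\<close> and \<open>\<beta> / \<gamma>\<close> are
  conjugates of the same \<open>u\<close>. Thus \<open>w = \<alpha> / \<gamma>\<close> satisfies
  \<open>w ^ (p ^ m) = b w\<close> with \<open>b = \<beta> / \<alpha>\<close> and some
  \<open>m\<close> strictly between 0 and \<open>d\<close>. Since \<open>w\<close> determines
  \<open>\<gamma>\<close>, the bounds for the separate \<open>m\<close> add up.\<close>

lemma (in field) C_basis_indistinguishing:
  assumes p: "Factorial_Ring.prime p" and order: "order R = (p::nat) ^ d"
    and \<alpha>: "\<alpha> \<in> carrier R - {\<zero>}" and \<beta>: "\<beta> \<in> carrier R - {\<zero>}" and "\<alpha> \<noteq> \<beta>"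
  shows "card {\<gamma> \<in> carrier R - {\<zero>}. \<exists>r \<in> C_basis R. (\<gamma>, \<alpha>) \<in> r \<and> (\<gamma>, \<beta>) \<in> r}
    \<le> (\<Sum>m = 1..<d. p ^ gcd m d - 1)"
proof -
  define A where "A = {\<gamma> \<in> carrier R - {\<zero>}. \<exists>r \<in> C_basis R. (\<gamma>, \<alpha>) \<in> r \<and> (\<gamma>, \<beta>) \<in> r}"
  define b where "b = \<beta> \<otimes> inv \<alpha>"
  define W where "W m = {w \<in> carrier R - {\<zero>}. w [^] (p ^ m) = b \<otimes> w}" for m
  have fin: "finite (carrier R)"
    using order prime_gt_0_nat[OF p] by (intro card_ge_0_finite) (simp add: order_def)
  have inv: "inv x \<in> carrier R - {\<zero>}" "x \<otimes> inv x = \<one>" if "x \<in> carrier R - {\<zero>}" for x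
    using that Units_inv_Units[of x] by (auto simp: field_Units)
  have b: "b \<in> carrier R" "b \<otimes> \<alpha> = \<beta>"
    using \<alpha> \<beta> inv[OF \<alpha>] by (auto simp: b_def m_assoc m_comm[of "inv \<alpha>"])
  have mem: "\<alpha> \<otimes> inv \<gamma> \<in> (\<Union>m\<in>{1..<d}. W m)" if \<gamma>A: "\<gamma> \<in> A" for \<gamma>
  proof -
    obtain r where r: "r \<in> C_basis R" "(\<gamma>, \<alpha>) \<in> r" "(\<gamma>, \<beta>) \<in> r" and \<gamma>: "\<gamma> \<in> carrier R - {\<zero>}"
      using \<gamma>A unfolding A_def by blast
    obtain u where u: "u \<in> carrier R - {\<zero>}"
      "\<And>\<alpha> \<beta>. (\<alpha>, \<beta>) \<in> r \<Longrightarrow> \<exists>i<d. \<beta> = \<alpha> \<otimes> u [^] (p ^ i)"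
      using C_basis_pair[OF p order r(1)] by metis
    obtain i where i: "i < d" "\<alpha> = \<gamma> \<otimes> u [^] (p ^ i)" using u(2)[OF r(2)] by blast
    obtain j where j: "j < d" "\<beta> = \<gamma> \<otimes> u [^] (p ^ j)" using u(2)[OF r(3)] by blast
    define w where "w = \<alpha> \<otimes> inv \<gamma>"
    have cancel: "\<gamma> \<otimes> z \<otimes> inv \<gamma> = z" if "z \<in> carrier R" for z
      using inv[OF \<gamma>] \<gamma> that m_lcomm[of \<gamma> z "inv \<gamma>"] by (simp add: m_assoc)
    have w: "w = u [^] (p ^ i)" "b \<otimes> w = u [^] (p ^ j)"
    proof -
      show "w = u [^] (p ^ i)" using cancel u i by (simp add: w_def)
      have "b \<otimes> w = b \<otimes> \<alpha> \<otimes> inv \<gamma>"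
        unfolding w_def by (rule m_assoc[symmetric]) (use b(1) \<alpha> inv[OF \<gamma>] in auto)
      then show "b \<otimes> w = u [^] (p ^ j)" using cancel u j b by simp
    qed
    \<comment> \<open>The residue of \<open>j - i\<close> modulo \<open>d\<close>; it is nonzero
      because \<open>\<alpha>\<close> and \<open>\<beta>\<close> differ.\<close>
    define m where "m = (if i < j then j - i else j + d - i)"
    have "i \<noteq> j" using i j \<open>\<alpha> \<noteq> \<beta>\<close> by auto
    then have m: "m \<in> {1..<d}" using i j by (auto simp: m_def)
    have "w [^] (p ^ m) = u [^] (p ^ (i + m))" using u by (simp add: w(1) nat_pow_pow power_add)
    also have "\<dots> = u [^] (p ^ j)"
    proof (cases "i < j")
      case False
      then have "i + m = d + j" using i by (simp add: m_def)
      then have "u [^] (p ^ (i + m)) = (u [^] (p ^ d)) [^] (p ^ j)"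
        using u by (simp add: nat_pow_pow power_add)
      then show ?thesis using prime_power_field_pow_order[OF p order] u by simp
    qed (simp add: m_def)
    finally have "w [^] (p ^ m) = b \<otimes> w" using w by simp
    moreover have "w \<in> carrier R - {\<zero>}" using \<alpha> inv[OF \<gamma>] by (auto simp: w_def integral_iff)
    ultimately show ?thesis using m by (auto simp: W_def w_def)
  qed
  have "inj_on (\<lambda>\<gamma>. \<alpha> \<otimes> inv \<gamma>) A"
  proof (rule inj_onI)
    fix x y assume xy: "x \<in> A" "y \<in> A" "\<alpha> \<otimes> inv x = \<alpha> \<otimes> inv y"
    then have x: "x \<in> carrier R - {\<zero>}" and y: "y \<in> carrier R - {\<zero>}" by (auto simp: A_def)
    have "inv x = inv y" using xy(3) \<alpha> inv[OF x] inv[OF y] m_lcancel[of \<alpha>] by simp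
    then show "x = y" using x y by (metis Units_inv_inv field_Units)
  qed
  then have "card A \<le> card (\<Union>m\<in>{1..<d}. W m)"
    using mem fin by (intro card_inj_on_le[of "\<lambda>\<gamma>. \<alpha> \<otimes> inv \<gamma>"]) (auto simp: W_def)
  also have "\<dots> \<le> (\<Sum>m\<in>{1..<d}. card (W m))" by (intro card_UN_le) simp
  also have "\<dots> \<le> (\<Sum>m\<in>{1..<d}. p ^ gcd m d - 1)"
    using frobenius_eigenspace_card[OF p order _ b(1)] by (intro sum_mono) (simp add: W_def)
  finally show ?thesis by (simp add: A_def)
qed

lemma (in field) C_basis_cover:
  assumes "x \<in> carrier R - {\<zero>}" "y \<in> carrier R - {\<zero>}"
  obtains r where "r \<in> C_basis R" "(x, y) \<in> r"
proof (rule that)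
  let ?r = "{(a \<otimes> \<sigma> x, a \<otimes> \<sigma> y) | a \<sigma>. a \<in> carrier R - {\<zero>} \<and> \<sigma> \<in> ring_iso R R}"
  show "?r \<in> C_basis R" using assms unfolding C_basis_def by blast
  have "id \<in> ring_iso R R" by (simp add: ring_iso_def ring_hom_def)
  then have "(\<one> \<otimes> id x, \<one> \<otimes> id y) \<in> ?r" using one_not_zero by blast
  then show "(x, y) \<in> ?r" using assms by simp
qed

section \<open>The numerical condition\<close>

text \<open>From 4 on, passing from \<open>k\<close> to \<open>k + 1\<close> at most doubles the
  cube, while the power grows by the factor \<open>p\<close>. The constant 24 is the one that arises
  in \<open>gcd_power_sum_less_cubic\<close>.\<close>

lemma cubic_le_power:
  fixes p k l :: nat
  assumes "2 \<le> p" "4 \<le> l" "24 * l ^ 3 \<le> p ^ l" "l \<le> k"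
  shows "24 * k ^ 3 \<le> p ^ k"
  using \<open>l \<le> k\<close>
proof (induction k rule: dec_induct)
  case (step k)
  have "4 * k ^ 2 \<le> k ^ 3" using assms(2) step by (simp add: power3_eq_cube power2_eq_square)
  have "4 * k \<le> k ^ 2" using assms(2) step by (simp add: power2_eq_square)
  have "(Suc k) ^ 3 \<le> 2 * k ^ 3"
  proof -
    have "Suc k ^ 3 = k ^ 3 + 3 * k ^ 2 + 3 * k + 1"
      by (simp add: power3_eq_cube power2_eq_square algebra_simps)
    then show ?thesis
      using \<open>4 * k ^ 2 \<le> k ^ 3\<close> \<open>4 * k \<le> k ^ 2\<close> assms(2) step(1) by linarith
  qed
  then have "24 * Suc k ^ 3 \<le> 2 * p ^ k" using step by linarith
  also have "\<dots> \<le> p ^ Suc k" using assms(1) by simp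
  finally show ?case .
qed (use assms in simp)

text \<open>Each gcd is a proper divisor of \<open>d\<close>, hence at most half of it.\<close>

lemma gcd_power_sum_le:
  fixes p d :: nat
  assumes "0 < p"
  shows "(\<Sum>m = 1..<d. p ^ gcd m d - 1) \<le> (d - 1) * (p ^ (d div 2) - 1)"
proof -
  have "gcd m d \<le> d div 2" if m: "m \<in> {1..<d}" for m
  proof -
    obtain q where q: "d = gcd m d * q" by (meson dvdE gcd_dvd2)
    have "m \<noteq> 0" "m < d" using m by auto
    then have "gcd m d < d" using gcd_le1_nat[of m d] by linarith
    then have "q \<noteq> 0" "q \<noteq> 1"
      using q \<open>m < d\<close> by (metis mult_0_right less_nat_zero_code, metis mult_1_right less_irrefl)
    then have "gcd m d * 2 \<le> gcd m d * q" by (intro mult_le_mono2) simp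
    then show ?thesis using q by linarith
  qed
  then have "(\<Sum>m = 1..<d. p ^ gcd m d - 1) \<le> (\<Sum>m = 1..<d. p ^ (d div 2) - 1)"
    using assms by (intro sum_mono diff_le_mono power_increasing) auto
  then show ?thesis by simp
qed

text \<open>With \<open>e = d div 2\<close>, the left side is at most
  \<open>p ^ (d - e) * (p ^ e - 1) = p ^ d - p ^ (d - e)\<close>, and the subtracted power exceeds
  1.\<close>

lemma gcd_power_sum_less_power:
  fixes p d :: nat
  assumes "2 \<le> p" "1 \<le> d" "3 * d * (d - 1) ^ 2 \<le> p ^ (d - d div 2)"
  shows "3 * (\<Sum>m = 1..<d. p ^ gcd m d - 1) * d * (d - 1) < p ^ d - 1"
proof -
  define e where "e = d div 2"
  have "3 * (\<Sum>m = 1..<d. p ^ gcd m d - 1) * d * (d - 1) \<le> 3 * ((d - 1) * (p ^ e - 1)) * d * (d - 1)"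
    using gcd_power_sum_le[of p d] assms(1) unfolding e_def by (intro mult_le_mono) auto
  also have "\<dots> = 3 * d * (d - 1) ^ 2 * (p ^ e - 1)" by (simp add: power2_eq_square)
  also have "\<dots> \<le> p ^ (d - e) * (p ^ e - 1)" using assms(3) unfolding e_def by (rule mult_le_mono1)
  also have "\<dots> = p ^ d - p ^ (d - e)"
    by (simp add: diff_mult_distrib2 e_def flip: power_add)
  also have "\<dots> < p ^ d - 1"
  proof -
    have "1 < p ^ (d - e)" using assms by (intro one_less_power) (auto simp: e_def)
    moreover have "p ^ (d - e) \<le> p ^ d" using assms by (intro power_increasing) auto
    ultimately show ?thesis by linarith
  qed
  finally show ?thesis .
qed

text \<open>Reduces all large \<open>d\<close> to one inequality at \<open>l\<close>. The exponent
  \<open>d - d div 2\<close> is half of \<open>d\<close> rounded up, which the last assumption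
  bounds below by \<open>l\<close>. Twice this exponent bounds \<open>d\<close>, whence the factor
  24 from \<open>3 * 2 ^ 3\<close>.\<close>

lemma gcd_power_sum_less_cubic:
  fixes p d l :: nat
  assumes "2 \<le> p" "4 \<le> l" "24 * l ^ 3 \<le> p ^ l" "2 * l \<le> d + 1"
  shows "3 * (\<Sum>m = 1..<d. p ^ gcd m d - 1) * d * (d - 1) < p ^ d - 1"
proof (rule gcd_power_sum_less_power[OF assms(1)])
  define k where "k = d - d div 2"
  have k: "l \<le> k" "d \<le> 2 * k" "d - 1 \<le> 2 * k" using assms(4) by (auto simp: k_def)
  have "3 * d * (d - 1) ^ 2 \<le> 3 * (2 * k) * (2 * k) ^ 2"
    using k by (intro mult_le_mono power_mono) auto
  also have "\<dots> = 24 * k ^ 3" by (simp add: power3_eq_cube power2_eq_square)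
  also have "\<dots> \<le> p ^ k" by (rule cubic_le_power[OF assms(1-3) k(1)])
  finally show "3 * d * (d - 1) ^ 2 \<le> p ^ (d - d div 2)" by (simp add: k_def)
qed (use assms in simp)

section \<open>Evaluation in small degrees\<close>

text \<open>One step of Euclid's algorithm; as a rewrite rule it evaluates the gcd of two
  numerals.\<close>

lemma gcd_numeral_nat:
  "gcd (numeral m :: nat) (numeral n) = gcd (numeral n) (numeral m mod numeral n)"
  by (metis gcd.commute gcd_red_nat)

text \<open>Turns the sum into a list that rewriting can expand. The term for 1 is split off so that
  every remaining \<open>m\<close> is a numeral, and \<open>Suc 0\<close> appears on the left
  because the simplifier rewrites 1 to it.\<close>

lemma gcd_power_sum_upt:
  fixes p d :: nat
  assumes "2 \<le> d"
  shows "(\<Sum>m = Suc 0..<d. p ^ gcd m d - Suc 0) = (p - 1) + sum_list (map (\<lambda>m. p ^ gcd m d - 1) [2..<d])"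
proof -
  have "(\<Sum>m = 1..<d. p ^ gcd m d - 1) = (p ^ gcd 1 d - 1) + (\<Sum>m = Suc 1..<d. p ^ gcd m d - 1)"
    by (rule sum.atLeast_Suc_lessThan) (use assms in simp)
  then show ?thesis unfolding Suc_1 by (simp add: interv_sum_list_conv_sum_set_nat)
qed

lemma small_degree_2:
  "d \<in> set ([13, 17, 19] @ [21..<33]) \<Longrightarrow>
    3 * (\<Sum>m = 1..<d. 2 ^ gcd m d - 1) * d * (d - 1) < 2 ^ d - (1 :: nat)"
  by (simp, elim disjE; simp add: gcd_power_sum_upt gcd_numeral_nat)

lemma small_degree_3:
  "d \<in> set ([7, 9] @ [11..<17]) \<Longrightarrow>
    3 * (\<Sum>m = 1..<d. 3 ^ gcd m d - 1) * d * (d - 1) < 3 ^ d - (1 :: nat)"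
  by (simp, elim disjE; simp add: gcd_power_sum_upt gcd_numeral_nat)

lemma small_degree_5:
  "d \<in> {5, 7, 8} \<Longrightarrow>
    3 * (\<Sum>m = 1..<d. 5 ^ gcd m d - 1) * d * (d - 1) < 5 ^ d - (1 :: nat)"
  by (simp, elim disjE; simp add: gcd_power_sum_upt gcd_numeral_nat)

text \<open>For \<open>p = 7\<close> in degrees 4 and 6, and for \<open>p\<close> up to 10 in degree
  4, the estimate of \<open>gcd_power_sum_less_power\<close> is too weak. The composite values 8, 9
  and 10 satisfy the inequality as well, which keeps the case distinction to a comparison with
  11.\<close>

lemma small_degree_4_6:
  "(p, d) \<in> {(7, 4), (8, 4), (9, 4), (10, 4), (7, 6)} \<Longrightarrow>
    3 * (\<Sum>m = 1..<d. p ^ gcd m d - 1) * d * (d - 1) < p ^ d - (1 :: nat)"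
  by (simp, elim disjE; simp add: gcd_power_sum_upt gcd_numeral_nat)

lemma gcd_power_sum_less:
  fixes p d :: nat
  assumes "Factorial_Ring.prime p" "d \<ge> 1"
    and "\<not> (((p = 2 \<and> 2 \<le> d \<and> d \<le> 20) \<or> (p = 3 \<and> 2 \<le> d \<and> d \<le> 10) \<or> (p = 5 \<and> 2 \<le> d \<and> d \<le> 6)) \<and>
            (p, d) \<notin> {(2, 13), (2, 17), (2, 19), (3, 7), (3, 9), (5, 5)})"
  shows "3 * (\<Sum>m = 1..<d. p ^ gcd m d - 1) * d * (d - 1) < p ^ d - 1"
proof -
  have "p \<noteq> 4" "p \<noteq> 6" using assms(1) by (auto simp: prime_nat_numeral_eq)
  then consider "d = 1" | "p = 2" "d \<ge> 2" | "p = 3" "d \<ge> 2" | "p = 5" "d \<ge> 2" | "p \<ge> 7" "d \<ge> 2"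
    using assms(2) prime_ge_2_nat[OF assms(1)] by linarith
  then show ?thesis
  proof cases
    case 1
    then show ?thesis using prime_gt_1_nat[OF assms(1)] by simp
  next
    case 2
    show ?thesis
    proof (cases "d \<ge> 33")
      case True
      \<comment> \<open>The least \<open>l\<close> from 4 on with
        \<open>24 * l ^ 3 \<le> 2 ^ l\<close> is 17, and it covers \<open>d\<close> from
        \<open>2 * 17 - 1\<close> on. For 3 and 5 the corresponding values are 9 and 5.\<close>
      then show ?thesis by (intro gcd_power_sum_less_cubic[where l = 17]) (simp_all add: 2)
    next
      case False
      have "d \<in> {13, 17, 19} \<or> 21 \<le> d" using assms(3) 2 by (simp, linarith)
      then have "d \<in> set ([13, 17, 19] @ [21..<33])" using False by (auto simp del: upt_rec_numeral)
      then show ?thesis unfolding 2 by (rule small_degree_2)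
    qed
  next
    case 3
    show ?thesis
    proof (cases "d \<ge> 17")
      case True
      then show ?thesis by (intro gcd_power_sum_less_cubic[where l = 9]) (simp_all add: 3)
    next
      case False
      have "d \<in> {7, 9} \<or> 11 \<le> d" using assms(3) 3 by (simp, linarith)
      then have "d \<in> set ([7, 9] @ [11..<17])" using False by (auto simp del: upt_rec_numeral)
      then show ?thesis unfolding 3 by (rule small_degree_3)
    qed
  next
    case 4
    show ?thesis
    proof (cases "d \<ge> 9")
      case True
      then show ?thesis by (intro gcd_power_sum_less_cubic[where l = 5]) (simp_all add: 4)
    next
      case False
      then have "d \<in> {5, 7, 8}" using assms(3) 4 by (simp, linarith)
      then show ?thesis unfolding 4 by (rule small_degree_5)
    qed
  next
    case 5
    have pow: "7 ^ k \<le> p ^ k" for k using 5 by (intro power_mono) auto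
    consider "d \<ge> 9" | "d \<in> {2, 3, 5, 7, 8}" | "d = 4" | "d = 6" using 5 by force
    then show ?thesis
    proof cases
      case 1
      have "24 * 5 ^ 3 \<le> p ^ 5" using pow[of 5] by simp
      then show ?thesis using 1 5 by (intro gcd_power_sum_less_cubic[where l = 5]) simp_all
    next
      case 2
      \<comment> \<open>In these degrees the estimate holds at 7 and hence for all larger
        \<open>p\<close>.\<close>
      then have "3 * d * (d - 1) ^ 2 \<le> 7 ^ (d - d div 2)" by auto
      also have "\<dots> \<le> p ^ (d - d div 2)" by (rule pow)
      finally show ?thesis using 5 by (intro gcd_power_sum_less_power) auto
    next
      case d: 3
      show ?thesis
      proof (cases "p \<ge> 11")
        case True
        then have "11 ^ 2 \<le> p ^ 2" by (intro power_mono) auto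
        then show ?thesis using 5 by (intro gcd_power_sum_less_power) (simp_all add: d)
      next
        case False
        then have "p \<in> {7, 8, 9, 10}" using 5 by auto
        then show ?thesis using d by (intro small_degree_4_6) auto
      qed
    next
      case d: 4
      show ?thesis
      proof (cases "p \<ge> 8")
        case True
        then have "8 ^ 3 \<le> p ^ 3" by (intro power_mono) auto
        then show ?thesis using 5 by (intro gcd_power_sum_less_power) (simp_all add: d)
      next
        case False
        then have "p = 7" using 5 by simp
        then show ?thesis using d by (intro small_degree_4_6) simp
      qed
    qed
  qed
qed

section \<open>Fissions of \<open>C(p\<^sup>d)\<close>\<close>

lemma fission_refines:
  assumes "fission \<Omega> S T" "t \<in> T" "s \<in> S" "x \<in> t" "x \<in> s"
  shows "t \<subseteq> s"
proof -
  have "disjoint T"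
    using assms(1) unfolding fission_def coherent_configuration_def by (blast dest: partition_onD2)
  moreover obtain U where U: "U \<subseteq> T" "s = \<Union>U" using assms(1,3) unfolding fission_def by blast
  moreover obtain u where "u \<in> U" "x \<in> u" using U assms(5) by blast
  ultimately have "u = t" using assms(2,4) disjointD[of T u t] by blast
  then show ?thesis using U \<open>u \<in> U\<close> by blast
qed

theorem theorem1p2:
  fixes p d :: nat
    and F :: "('a, 'm) ring_scheme"
    and T :: "'a rel set"
  assumes "Factorial_Ring.prime p" and "d \<ge> 1"
    and "Ring.field F" and "order F = p ^ d"
    and "\<not> (((p = 2 \<and> 2 \<le> d \<and> d \<le> 20) \<or> (p = 3 \<and> 2 \<le> d \<and> d \<le> 10) \<or> (p = 5 \<and> 2 \<le> d \<and> d \<le> 6)) \<and>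
            (p, d) \<notin> {(2, 13), (2, 17), (2, 19), (3, 7), (3, 9), (5, 5)})"
    and "fission (carrier F - {\<zero>\<^bsub>F\<^esub>}) (C_basis F) T"
  shows "separable TYPE('b) (carrier F - {\<zero>\<^bsub>F\<^esub>}) T"
proof -
  interpret field F by fact
  define c where "c = (\<Sum>m = 1..<d. p ^ gcd m d - 1)"
  let ?\<Omega> = "carrier F - {\<zero>\<^bsub>F\<^esub>}"
  have fin: "finite (carrier F)"
    using assms(4) prime_gt_0_nat[OF assms(1)] by (intro card_ge_0_finite) (simp add: order_def)
  \<comment> \<open>Each relation of the fission lies inside a relation of the scheme, so valencies
    and sets of indistinguishing points can only shrink.\<close>
  have refine: "\<exists>r \<in> C_basis F. t \<subseteq> r" if t: "t \<in> T" and x: "x \<in> t" for t x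
  proof -
    have "x \<in> ?\<Omega> \<times> ?\<Omega>"
      using assms(6) t x partition_onD1[of "?\<Omega> \<times> ?\<Omega>" T]
      unfolding fission_def coherent_configuration_def by blast
    then obtain r where "r \<in> C_basis F" "x \<in> r"
      using C_basis_cover[of "fst x" "snd x"] by (cases x) auto
    then show ?thesis using fission_refines[OF assms(6) t _ x] by blast
  qed
  interpret bounded_coherent ?\<Omega> T d c
  proof
    show "coherent_configuration ?\<Omega> T" using assms(6) by (simp add: fission_def)
  next
    fix t \<alpha> assume t: "t \<in> T"
    show "card (t `` {\<alpha>}) \<le> d"
    proof (cases "t `` {\<alpha>} = {}")
      case False
      then obtain r where r: "r \<in> C_basis F" "t \<subseteq> r" using refine[OF t] by blast
      have "card (t `` {\<alpha>}) \<le> card (r `` {\<alpha>})"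
        by (intro card_mono C_basis_valency(2)[OF assms(1,4) r(1)] Image_mono r(2) order_refl)
      also have "\<dots> \<le> d" by (rule C_basis_valency(1)[OF assms(1,4) r(1)])
      finally show ?thesis .
    qed simp
  next
    fix \<alpha> \<beta> assume *: "\<alpha> \<in> ?\<Omega>" "\<beta> \<in> ?\<Omega>" "\<alpha> \<noteq> \<beta>"
    have "{\<gamma> \<in> ?\<Omega>. \<exists>r \<in> T. (\<gamma>, \<alpha>) \<in> r \<and> (\<gamma>, \<beta>) \<in> r}
        \<subseteq> {\<gamma> \<in> ?\<Omega>. \<exists>r \<in> C_basis F. (\<gamma>, \<alpha>) \<in> r \<and> (\<gamma>, \<beta>) \<in> r}"
    proof
      fix \<gamma> assume "\<gamma> \<in> {\<gamma> \<in> ?\<Omega>. \<exists>r \<in> T. (\<gamma>, \<alpha>) \<in> r \<and> (\<gamma>, \<beta>) \<in> r}"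
      then obtain t where t: "\<gamma> \<in> ?\<Omega>" "t \<in> T" "(\<gamma>, \<alpha>) \<in> t" "(\<gamma>, \<beta>) \<in> t" by blast
      obtain r where "r \<in> C_basis F" "t \<subseteq> r" using refine[OF t(2,3)] by blast
      then show "\<gamma> \<in> {\<gamma> \<in> ?\<Omega>. \<exists>r \<in> C_basis F. (\<gamma>, \<alpha>) \<in> r \<and> (\<gamma>, \<beta>) \<in> r}"
        using t by blast
    qed
    then have "card {\<gamma> \<in> ?\<Omega>. \<exists>r \<in> T. (\<gamma>, \<alpha>) \<in> r \<and> (\<gamma>, \<beta>) \<in> r}
        \<le> card {\<gamma> \<in> ?\<Omega>. \<exists>r \<in> C_basis F. (\<gamma>, \<alpha>) \<in> r \<and> (\<gamma>, \<beta>) \<in> r}"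
      by (rule card_mono[rotated]) (simp add: fin)
    also have "\<dots> \<le> c"
      unfolding c_def by (rule C_basis_indistinguishing[OF assms(1,4) *])
    finally show "card {\<gamma> \<in> ?\<Omega>. \<exists>r \<in> T. (\<gamma>, \<alpha>) \<in> r \<and> (\<gamma>, \<beta>) \<in> r} \<le> c" .
  next
    have "card ?\<Omega> = p ^ d - 1" using assms(4) fin by (simp add: order_def card_Diff_singleton)
    then show "3 * c * d * (d - 1) < card ?\<Omega>"
      using gcd_power_sum_less[OF assms(1,2,5)] by (simp add: c_def)
  qed
  show ?thesis by (rule bounded_separable)
qed

end
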